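(* Let $X$ be a generic $n\times m$ generalized diagonal matrix with ladders of zeros $L_1$ and $L_2$, let $r\ge 1$, and let $I=I_r(X)$. Suppose $L_1$ is a triangle or contained in an $(r-1)\times(r-1)$ triangle, and $L_2$ is a triangle or contained in an $(r-1)\times(r-1)$ triangle. Then $\Delta_I$, the Stanley–Reisner complex of the initial ideal of $I$, is vertex decomposable.
   Context: A generalized diagonal (GD) matrix is an $n\times m$ matrix with two ladders of zeros, $L_1$ (bottom left) and $L_2$ (top right): given positive integers $c_1\ge\dots\ge c_s$ with $s<m$, $c_1<n$, $L_1$ consists of the last $c_i$ entries of column $i$ for $i=1,\dots,s$; given positive integers $d_t\le\dots\le d_m$ with $t>1$, $d_m<n$, $L_2$ consists of the first $d_i$ entries of column $i$ for $i=t,\dots,m$; either ladder may be empty. It is generic if the entries outside $L_1\cup L_2$ are distinct indeterminates $x_{ij}$ over a field $k$; $R=k[X]$ is the polynomial ring in these entries. $L_1$ is a triangle of size $t_1\ge 0$ if $c_1=t_1,\ c_2=t_1-1,\dots,c_{t_1}=1$; $L_2$ is a triangle of size $t_2\ge 0$ if $d_{m-t_2+1}=1,\dots,d_m=t_2$; size $0$ means empty. "$L_1$ is contained in an $(r-1)\times(r-1)$ triangle" means that every position $(i,j)$ in $L_1$ satisfies $i-j\ge n-(r-1)$; "$L_2$ is contained in an $(r-1)\times(r-1)$ triangle" means that every position $(i,j)$ in $L_2$ satisfies $j-i\ge m-(r-1)$. $I_r(X)$ is the ideal of $r\times r$ minors of $X$. The monomial order on $R$ is lexicographic with $x_{ij}>x_{kl}$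 if $i<k$, or $i=k$ and $j<l$. The initial ideal $\mathrm{in}(I)$ is square-free. $\Delta_I$ is the simplicial complex with vertices labeled by the non-zero entries of $X$ whose faces are the sets of entries whose product is not in $\mathrm{in}(I)$. For a vertex $v$ of a complex $\Delta$, $\mathrm{Del}_v(\Delta)=\{G\in\Delta: v\notin G\}$ and $\mathrm{Link}_v(\Delta)=\{G\in\Delta: v\notin G,\ G\cup\{v\}\in\Delta\}$. A complex $\Delta$ is vertex decomposable if $\Delta=\{\emptyset\}$, or $\Delta$ is pure and has a vertex $v$ such that $\mathrm{Del}_v(\Delta)$ and $\mathrm{Link}_v(\Delta)$ are both vertex decomposable. *)

theory Defs
  imports
    "HOL-Library.Poly_Mapping"
    "HOL-Library.Product_Lexorder"
    "HOL-Algebra.Ideal"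
    "Jordan_Normal_Form.Determinant"
    "Jordan_Normal_Form.DL_Submatrix"
begin

section \<open>Polynomials in the entries of a matrix\<close>

text \<open>
  The indeterminate in row i and column j is indexed by the position (i, j), with i and j
  counted from 1. A monomial is its exponent vector, and a polynomial maps monomials to
  coefficients.
\<close>

type_synonym position = "nat \<times> nat"
type_synonym monom = "position \<Rightarrow>\<^sub>0 nat"
type_synonym 'k entry_poly = "monom \<Rightarrow>\<^sub>0 'k"

definition power_product :: "monom \<Rightarrow> 'k::field entry_poly" where
  "power_product u = Poly_Mapping.single u 1"

definition indet :: "position \<Rightarrow> 'k::field entry_poly" where
  "indet p = power_product (Poly_Mapping.single p 1)"

text \<open>The polynomial ring in the indeterminates at the positions in V only.\<close>

definition poly_ring :: "position set \<Rightarrow> 'k::field entry_poly ring" where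
  "poly_ring V =
     \<lparr>carrier = {f. \<forall>u \<in> Poly_Mapping.keys f. Poly_Mapping.keys u \<subseteq> V},
      monoid.mult = (*), one = 1, zero = 0, add = (+)\<rparr>"

text \<open>
  The type of monomials is linearly ordered by the library: a monomial is larger if it has the
  larger exponent at the least position where the two differ, positions being compared
  lexicographically. The two lemmas record that this is the lexicographic order in which
  x_ij is greater than x_kl iff i < k, or i = k and j < l.
\<close>

lemma monom_less_iff:
  fixes u w :: monom
  shows "u < w \<longleftrightarrow> (\<exists>p. Poly_Mapping.lookup u p < Poly_Mapping.lookup w p \<and>
           (\<forall>q<p. Poly_Mapping.lookup u q = Poly_Mapping.lookup w q))"
  by (simp add: less_poly_mapping.rep_eq less_fun_def)

lemma indet_order:
  "(Poly_Mapping.single (i, j) 1 :: monom) > Poly_Mapping.single (k, l) 1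
     \<longleftrightarrow> i < k \<or> i = k \<and> j < l"
proof -
  have *: "(Poly_Mapping.single q 1 :: monom) < Poly_Mapping.single p 1" if "p < q" for p q
    unfolding monom_less_iff
    using that by (intro exI[of _ p]) (auto simp: lookup_single when_def)
  have "(Poly_Mapping.single (k, l) 1 :: monom) < Poly_Mapping.single (i, j) 1
          \<longleftrightarrow> (i, j) < (k, l)"
    using *[of "(i, j)" "(k, l)"] *[of "(k, l)" "(i, j)"]
    by (metis less_asym less_linear less_irrefl)
  then show ?thesis by auto
qed

definition lead_monom :: "'k::field entry_poly \<Rightarrow> monom" where
  "lead_monom f = Max (Poly_Mapping.keys f)"

definition initial_ideal :: "position set \<Rightarrow> 'k::field entry_poly set \<Rightarrow> 'k entry_poly set" where
  "initial_ideal V I =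
     Idl\<^bsub>poly_ring V\<^esub> {power_product (lead_monom f) | f. f \<in> I \<and> f \<noteq> 0}"

definition minors :: "nat \<Rightarrow> 'a::comm_ring_1 mat \<Rightarrow> 'a set" where
  "minors r X = {det (submatrix X A B) | A B.
     A \<subseteq> {..<dim_row X} \<and> B \<subseteq> {..<dim_col X} \<and> card A = r \<and> card B = r}"

definition minor_ideal ::
    "position set \<Rightarrow> nat \<Rightarrow> 'k::field entry_poly mat \<Rightarrow> 'k entry_poly set" where
  "minor_ideal V r X = Idl\<^bsub>poly_ring V\<^esub> (minors r X)"


section \<open>Generalized diagonal matrices\<close>

text \<open>
  The columns meeting the lower left ladder are 1, ..., s, those meeting the upper right ladder
  are t, ..., m. The ladders are empty for s = 0 and t = m + 1 respectively.
\<close>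

definition gd_data ::
    "nat \<Rightarrow> nat \<Rightarrow> nat \<Rightarrow> (nat \<Rightarrow> nat) \<Rightarrow> nat \<Rightarrow> (nat \<Rightarrow> nat) \<Rightarrow> bool" where
  "gd_data n m s c t d \<longleftrightarrow>
     1 \<le> n \<and> 1 \<le> m \<and>
     s < m \<and> (\<forall>i\<in>{1..s}. 0 < c i) \<and> antimono_on {1..s} c \<and> (1 \<le> s \<longrightarrow> c 1 < n) \<and>
     1 < t \<and> t \<le> m + 1 \<and> (\<forall>i\<in>{t..m}. 0 < d i) \<and> mono_on {t..m} d \<and> (t \<le> m \<longrightarrow> d m < n)"

definition lower_ladder :: "nat \<Rightarrow> nat \<Rightarrow> (nat \<Rightarrow> nat) \<Rightarrow> position set" where
  "lower_ladder n s c = {(i, j). j \<in> {1..s} \<and> i \<in> {n - c j <.. n}}"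

definition upper_ladder :: "nat \<Rightarrow> nat \<Rightarrow> (nat \<Rightarrow> nat) \<Rightarrow> position set" where
  "upper_ladder m t d = {(i, j). j \<in> {t..m} \<and> i \<in> {1..d j}}"

definition lower_triangle :: "nat \<Rightarrow> (nat \<Rightarrow> nat) \<Rightarrow> nat \<Rightarrow> bool" where
  "lower_triangle s c t1 \<longleftrightarrow> s = t1 \<and> (\<forall>i\<in>{1..t1}. c i = t1 + 1 - i)"

definition upper_triangle :: "nat \<Rightarrow> nat \<Rightarrow> (nat \<Rightarrow> nat) \<Rightarrow> nat \<Rightarrow> bool" where
  "upper_triangle m t d t2 \<longleftrightarrow> t + t2 = m + 1 \<and> (\<forall>i\<in>{1..t2}. d (m - t2 + i) = i)"

definition lower_in_triangle :: "nat \<Rightarrow> nat \<Rightarrow> position set \<Rightarrow> bool" where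
  "lower_in_triangle n r L \<longleftrightarrow> (\<forall>(i, j)\<in>L. int i - int j \<ge> int n - (int r - 1))"

definition upper_in_triangle :: "nat \<Rightarrow> nat \<Rightarrow> position set \<Rightarrow> bool" where
  "upper_in_triangle m r L \<longleftrightarrow> (\<forall>(i, j)\<in>L. int j - int i \<ge> int m - (int r - 1))"

definition nonzero_positions :: "nat \<Rightarrow> nat \<Rightarrow> position set \<Rightarrow> position set" where
  "nonzero_positions n m Z = {1..n} \<times> {1..m} - Z"

text \<open>Matrix indices start at 0, positions at 1, hence the shift.\<close>

definition generic_matrix :: "nat \<Rightarrow> nat \<Rightarrow> position set \<Rightarrow> 'k::field entry_poly mat" where
  "generic_matrix n m Z =
     mat n m (\<lambda>(i, j). if (i + 1, j + 1) \<in> Z then 0 else indet (i + 1, j + 1))"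


section \<open>Simplicial complexes\<close>

definition simplicial_complex :: "'v set set \<Rightarrow> bool" where
  "simplicial_complex \<Delta> \<longleftrightarrow>
     \<Delta> \<noteq> {} \<and> finite (\<Union>\<Delta>) \<and> (\<forall>F\<in>\<Delta>. \<forall>G. G \<subseteq> F \<longrightarrow> G \<in> \<Delta>)"

definition facets :: "'v set set \<Rightarrow> 'v set set" where
  "facets \<Delta> = {F \<in> \<Delta>. \<forall>G\<in>\<Delta>. F \<subseteq> G \<longrightarrow> G = F}"

definition pure :: "'v set set \<Rightarrow> bool" where
  "pure \<Delta> \<longleftrightarrow> (\<forall>F\<in>facets \<Delta>. \<forall>G\<in>facets \<Delta>. card F = card G)"

definition deletion :: "'v \<Rightarrow> 'v set set \<Rightarrow> 'v set set" where
  "deletion v \<Delta> = {G \<in> \<Delta>. v \<notin> G}"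

definition link :: "'v \<Rightarrow> 'v set set \<Rightarrow> 'v set set" where
  "link v \<Delta> = {G \<in> \<Delta>. v \<notin> G \<and> insert v G \<in> \<Delta>}"

inductive vertex_decomposable :: "'v set set \<Rightarrow> bool" where
  empty_face: "vertex_decomposable {{}}"
| decompose: "simplicial_complex \<Delta> \<Longrightarrow> pure \<Delta> \<Longrightarrow> {v} \<in> \<Delta> \<Longrightarrow>
    vertex_decomposable (deletion v \<Delta>) \<Longrightarrow> vertex_decomposable (link v \<Delta>) \<Longrightarrow>
    vertex_decomposable \<Delta>"

text \<open>
  The complex of an ideal I of the polynomial ring over V. Its faces are subsets of V; a
  position v in V with x_v in the initial ideal is a label that does not occur in any face.
\<close>

definition initial_complex ::
    "position set \<Rightarrow> 'k::field entry_poly set \<Rightarrow> position set set" where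
  "initial_complex V I = {F. F \<subseteq> V \<and> (\<Prod>v\<in>F. indet v) \<notin> initial_ideal V I}"

end

theory Submission
  imports Defs
begin

text \<open>
  Write \<open>p \<lless> q\<close> if q lies in a later row and a later column than p, and call a set of positions
  that is totally ordered by \<open>\<lless>\<close> a chain. The proof has two independent halves: the faces of the
  complex are the sets F of non-zero positions that contain no chain of r positions
  (\<open>initial_complex_eq_chain_complex\<close>), and the complex of these sets is vertex decomposable
  (\<open>vertex_decomposable_chain_complex\<close>).

  For the first half, a chain of r non-zero positions is the diagonal of a minor, and every other
  term of that minor is zero or smaller, so the product over the chain is a leading monomial. What has to be
  excluded is an f in the ideal whose leading monomial u has a support F without such a chain. Sort
  the positions of F into layers by the length of the longest chain of F that ends there. There are
  at most r - 1 layers, each of them is an antichain, and the smallest rectangle around an antichain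
  of non-zero positions consists of non-zero positions. For each layer there is a rank-one matrix
  supported in its rectangle whose entries are Laurent monomials. The exponents are compared in the
  lexicographic order that extends the monomial order; the entry at v is bounded by the
  indeterminate at v, with equality exactly on the layer (\<open>rank_one_weights\<close>,
  \<open>rank_one_layer\<close>). The sum of these matrices has the prescribed zeros and rank less than r, so f
  vanishes on it; but on it the monomial u attains its bound with coefficient 1, and all other
  monomials of f stay strictly below that bound, so f does not vanish
  (\<open>low_rank_matrix\<close>, \<open>substitute_neq_0\<close>, \<open>lead_monom_contains_chain\<close>).

  For the second half, decide the positions one by one in lexicographic order. All complexes that
  arise as links and deletions are given by the set T of undecided positions, a final segment, and
  the set F0 of positions taken so far: their faces are the subsets G of T for which
  \<open>F0 \<union> G\<close> has no chain of r positions. Only purity is needed for each of them, and it is shown by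
  counting a facet along each diagonal j - i = const
  (\<open>facet_diagonal_count\<close>, \<open>pure_chain_complex\<close>). This is where the shape of the ladders enters. A
  triangle removes whole diagonals, and along a diagonal without zeros the number of positions of a
  facet is forced by T and F0. A ladder inside an \<open>(r - 1) \<times> (r - 1)\<close> triangle meets only diagonals
  whose positions lie on no chain of r positions at all, so they belong to every facet.
\<close>

section \<open>Chains of positions\<close>

definition strictly_southeast :: "position \<Rightarrow> position \<Rightarrow> bool" (infix "\<lless>" 50) where
  "p \<lless> q \<longleftrightarrow> fst p < fst q \<and> snd p < snd q"

definition strict_chains :: "position set \<Rightarrow> position list set" where
  "strict_chains F = {xs. set xs \<subseteq> F \<and> sorted_wrt (\<lless>) xs}"

definition height :: "position set \<Rightarrow> nat" where
  "height F = Max (length ` strict_chains F)"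

lemma southeast_irrefl [simp]: "\<not> p \<lless> p"
  by (simp add: strictly_southeast_def)

lemma distinct_chain: "sorted_wrt (\<lless>) xs \<Longrightarrow> distinct xs"
  by (induction xs) auto

lemma finite_strict_chains: "finite F \<Longrightarrow> finite (strict_chains F)"
  by (rule finite_subset[OF _ finite_subset_distinct[of F]])
    (auto simp: strict_chains_def distinct_chain)

lemma length_le_height: "finite F \<Longrightarrow> xs \<in> strict_chains F \<Longrightarrow> length xs \<le> height F"
  unfolding height_def by (intro Max_ge) (auto simp: finite_strict_chains)

lemma height_attained:
  assumes "finite F"
  obtains xs where "xs \<in> strict_chains F" "length xs = height F"
proof -
  have "[] \<in> strict_chains F" by (simp add: strict_chains_def)
  then have "height F \<in> length ` strict_chains F"
    unfolding height_def using assms by (intro Max_in) (auto simp: finite_strict_chains)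
  then show ?thesis using that by auto
qed

lemma height_leI: "finite F \<Longrightarrow> (\<And>xs. xs \<in> strict_chains F \<Longrightarrow> length xs \<le> k) \<Longrightarrow> height F \<le> k"
  by (metis height_attained)

lemma strict_chains_mono: "F \<subseteq> G \<Longrightarrow> strict_chains F \<subseteq> strict_chains G"
  by (auto simp: strict_chains_def)

lemma height_mono:
  assumes "finite G" "F \<subseteq> G" shows "height F \<le> height G"
proof (rule height_leI)
  show "finite F" using assms by (rule finite_subset[rotated])
  fix xs assume "xs \<in> strict_chains F"
  then have "xs \<in> strict_chains G" using strict_chains_mono[OF assms(2)] by (rule subsetD[rotated])
  then show "length xs \<le> height G" by (rule length_le_height[OF assms(1)])
qed

lemma height_add_le:
  assumes "finite F" "A \<subseteq> F" "B \<subseteq> F" "\<And>a b. a \<in> A \<Longrightarrow> b \<in> B \<Longrightarrow> a \<lless> b"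
  shows "height A + height B \<le> height F"
proof -
  have fin: "finite A" "finite B" using assms(1-3) by (auto intro: finite_subset)
  obtain xs where xs: "xs \<in> strict_chains A" "length xs = height A"
    by (rule height_attained[OF fin(1)])
  obtain ys where ys: "ys \<in> strict_chains B" "length ys = height B"
    by (rule height_attained[OF fin(2)])
  have "xs @ ys \<in> strict_chains F"
    using xs(1) ys(1) assms(2,3) assms(4)[OF subsetD subsetD, of "set xs" _ "set ys"]
    by (auto simp add: strict_chains_def sorted_wrt_append)
  then have "length (xs @ ys) \<le> height F" by (rule length_le_height[OF assms(1)])
  then show ?thesis using xs ys by simp
qed

lemma height_singleton: "height {v} = 1"
proof (rule antisym)
  show "height {v} \<le> 1"
  proof (rule height_leI)
    fix xs assume "xs \<in> strict_chains {v}"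
    then have "set xs \<subseteq> {v}" "distinct xs" by (auto simp: strict_chains_def distinct_chain)
    then show "length xs \<le> 1"
      by (metis card_mono card_1_singleton_iff distinct_card finite.emptyI finite.insertI One_nat_def)
  qed simp
  have "[v] \<in> strict_chains {v}" by (simp add: strict_chains_def)
  then show "1 \<le> height {v}" using length_le_height[of "{v}" "[v]"] by simp
qed

lemma height_through_le:
  assumes "finite F" "v \<in> F"
  shows "height {p \<in> F. p \<lless> v} + 1 + height {p \<in> F. v \<lless> p} \<le> height F"
proof -
  have "height {p \<in> F. p \<lless> v} + height {v} \<le> height {p \<in> F. p \<lless> v \<or> p = v}"
    by (rule height_add_le) (use assms in auto)
  moreover have "height {p \<in> F. p \<lless> v \<or> p = v} + height {p \<in> F. v \<lless> p} \<le> height F"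
    using assms(1) by (rule height_add_le) (auto simp: strictly_southeast_def)
  ultimately show ?thesis by (simp add: height_singleton)
qed

lemma chain_through_le:
  assumes "finite F" "xs \<in> strict_chains F" "v \<in> set xs"
  shows "length xs \<le> height {p \<in> F. p \<lless> v} + 1 + height {p \<in> F. v \<lless> p}"
proof -
  obtain as bs where xs: "xs = as @ v # bs" using assms(3) by (meson split_list)
  have "as \<in> strict_chains {p \<in> F. p \<lless> v}" "bs \<in> strict_chains {p \<in> F. v \<lless> p}"
    using assms(2) by (auto simp: strict_chains_def xs sorted_wrt_append)
  then have "length as \<le> height {p \<in> F. p \<lless> v}" "length bs \<le> height {p \<in> F. v \<lless> p}"
    using assms(1) by (auto intro!: length_le_height)
  then show ?thesis by (simp add: xs)
qed

text \<open>
  A chain that is too long for F uses v; its parts before and after v are chains of F.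
\<close>
lemma height_insert_exceeds:
  assumes "finite F" "height F < r" "r \<le> height (insert v F)"
  shows "r \<le> height {p \<in> F. p \<lless> v} + 1 + height {p \<in> F. v \<lless> p}"
proof -
  obtain xs where xs: "xs \<in> strict_chains (insert v F)" "length xs = height (insert v F)"
    by (rule height_attained[of "insert v F"]) (use assms(1) in simp)
  have "v \<in> set xs"
  proof (rule ccontr)
    assume "v \<notin> set xs"
    then have "xs \<in> strict_chains F" using xs(1) by (auto simp: strict_chains_def)
    then have "length xs \<le> height F" by (rule length_le_height[OF assms(1)])
    then show False using xs(2) assms(2,3) by simp
  qed
  then have "length xs \<le> height {p \<in> insert v F. p \<lless> v} + 1 + height {p \<in> insert v F. v \<lless> p}"
    using chain_through_le[OF _ xs(1)] assms(1) by simp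
  moreover have "{p \<in> insert v F. p \<lless> v} = {p \<in> F. p \<lless> v}"
    "{p \<in> insert v F. v \<lless> p} = {p \<in> F. v \<lless> p}" by auto
  ultimately show ?thesis using xs(2) assms(3) by simp
qed

lemma height_le_card_rows:
  assumes "finite F" "finite R" "fst ` F \<subseteq> R" shows "height F \<le> card R"
proof (rule height_leI[OF assms(1)])
  fix xs assume "xs \<in> strict_chains F"
  then have xs: "sorted_wrt (\<lless>) xs" "set xs \<subseteq> F" by (auto simp: strict_chains_def)
  have "sorted_wrt (<) (map fst xs)"
    unfolding sorted_wrt_map
    by (rule sorted_wrt_mono_rel[OF _ xs(1)]) (simp add: strictly_southeast_def)
  moreover have "set (map fst xs) \<subseteq> R" using xs(2) assms(3) by auto
  ultimately show "length xs \<le> card R"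
    by (metis assms(2) card_mono distinct_card length_map strict_sorted_iff)
qed

lemma height_le_card_columns:
  assumes "finite F" "finite R" "snd ` F \<subseteq> R" shows "height F \<le> card R"
proof (rule height_leI[OF assms(1)])
  fix xs assume "xs \<in> strict_chains F"
  then have xs: "sorted_wrt (\<lless>) xs" "set xs \<subseteq> F" by (auto simp: strict_chains_def)
  have "sorted_wrt (<) (map snd xs)"
    unfolding sorted_wrt_map
    by (rule sorted_wrt_mono_rel[OF _ xs(1)]) (simp add: strictly_southeast_def)
  moreover have "set (map snd xs) \<subseteq> R" using xs(2) assms(3) by auto
  ultimately show "length xs \<le> card R"
    by (metis assms(2) card_mono distinct_card length_map strict_sorted_iff)
qed

text \<open>
  Only the last position of a chain can lie in the additional row or column.
\<close>
lemma height_corner_Suc_le: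
  assumes "finite F"
  shows "height {p \<in> F. p \<lless> (Suc i, Suc j)} \<le> Suc (height {p \<in> F. p \<lless> (i, j)})"
proof (rule height_leI)
  fix xs assume xs: "xs \<in> strict_chains {p \<in> F. p \<lless> (Suc i, Suc j)}"
  show "length xs \<le> Suc (height {p \<in> F. p \<lless> (i, j)})"
  proof (cases xs rule: rev_cases)
    case (snoc ys v)
    then have "ys \<in> strict_chains {p \<in> F. p \<lless> (i, j)}"
      using xs
      by (auto simp: strict_chains_def sorted_wrt_append strictly_southeast_def)
    then have "length ys \<le> height {p \<in> F. p \<lless> (i, j)}"
      by (rule length_le_height[rotated]) (use assms in simp)
    then show ?thesis using snoc by simp
  qed simp
qed (use assms in simp)


section \<open>Complexes without long chains\<close>

text \<open>
  Here T stands for the positions still to be decided and F0 for those already taken; links and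
  deletions at vertices of T lead to complexes of the same form.
\<close>
definition chain_complex :: "nat \<Rightarrow> position set \<Rightarrow> position set \<Rightarrow> position set set" where
  "chain_complex r T F0 = {G. G \<subseteq> T \<and> height (F0 \<union> G) < r}"

text \<open>
  A facet omits a position of T only if this position would complete a chain of r positions.
\<close>
lemma facet_blocked:
  assumes "finite T" "finite F0" and G: "G \<in> facets (chain_complex r T F0)"
    and v: "v \<in> T" "v \<notin> G"
  shows "r \<le> height {p \<in> F0 \<union> G. p \<lless> v} + 1 + height {p \<in> F0 \<union> G. v \<lless> p}"
proof (rule height_insert_exceeds)
  have GT: "G \<subseteq> T" and h: "height (F0 \<union> G) < r"
    using G by (auto simp: facets_def chain_complex_def)
  show "finite (F0 \<union> G)" using assms(1,2) GT finite_subset by blast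
  show "height (F0 \<union> G) < r" by (rule h)
  have "insert v G \<notin> chain_complex r T F0"
    using G v by (auto simp: facets_def)
  then show "r \<le> height (insert v (F0 \<union> G))"
    using GT v by (auto simp: chain_complex_def)
qed

lemma increment_count:
  fixes a :: "nat \<Rightarrow> nat"
  assumes "\<And>t. t < l \<Longrightarrow> a (Suc t) = a t + (if P t then 1 else 0)"
  shows "a l = a 0 + card {t. t < l \<and> P t}"
  using assms
proof (induction l)
  case (Suc l)
  have "{t. t < Suc l \<and> P t} = {t. t < l \<and> P t} \<union> (if P l then {l} else {})"
    by (auto simp: less_Suc_eq)
  then show ?case using Suc by simp
qed simp

text \<open>
  Walk down a diagonal without zeros, starting at its first position in T, and let \<open>a t\<close> be the
  length of the longest chain strictly northwest of the t-th position. It grows by at most one per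
  step, and it grows exactly at the positions of the facet: if it grew at a missing position, the
  chain responsible for the growth could be continued by the chain to the southeast that
  \<open>facet_blocked\<close> provides. So the count is the total growth. The initial value is determined
  by F0, and the final value is as large as the bound r - 1 and the length l of the walk permit.
\<close>
lemma facet_diagonal_count:
  assumes V: "V \<subseteq> {1..n} \<times> {1..m}" and T: "T \<subseteq> V"
    and final: "\<And>p q. p \<in> T \<Longrightarrow> q \<in> V \<Longrightarrow> p < q \<Longrightarrow> q \<in> T"
    and F0: "F0 \<subseteq> V - T"
    and G: "G \<in> facets (chain_complex r T F0)"
    and first: "(i, j) \<in> T" "\<And>i' j'. (i', j') \<in> T \<Longrightarrow> int j' - int i' = int j - int i \<Longrightarrow> i \<le> i'"
    and full: "\<And>i' j'. (i', j') \<in> {1..n} \<times> {1..m} \<Longrightarrow> int j' - int i' = int j - int i \<Longrightarrow> (i', j') \<in> V"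
    and l: "l = Suc (min (n - i) (m - j))" and a0: "a0 = height {p \<in> F0. p \<lless> (i, j)}"
  shows "card {v \<in> G. int (snd v) - int (fst v) = int j - int i} + a0 = min (r - 1) (a0 + l)"
proof -
  define F where "F = F0 \<union> G"
  define q where "q t = (i + t, j + t)" for t
  define a where "a t = height {p \<in> F. p \<lless> q t}" for t
  have fV: "finite V" using V finite_subset by blast
  then have fT: "finite T" and fF0: "finite F0" using T F0 finite_subset by blast+
  have GT: "G \<subseteq> T" and hF: "height F < r" using G by (auto simp: facets_def chain_complex_def F_def)
  have fF: "finite F" using fF0 fT GT finite_subset by (auto simp: F_def)
  have FV: "F \<subseteq> V" using F0 GT T by (auto simp: F_def)
  have ij: "1 \<le> i" "i \<le> n" "1 \<le> j" "j \<le> m" using first(1) T V by auto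
  have qT: "q t \<in> T" if "t < l" for t
  proof (cases t)
    case 0 then show ?thesis using first by (simp add: q_def)
  next
    case (Suc t')
    have "q t \<in> V" unfolding q_def by (rule full) (use ij that l in auto)
    then show ?thesis using final[OF first(1)] Suc by (simp add: q_def)
  qed
  \<comment> \<open>Nothing of G lies strictly northwest of the first position of T on the diagonal: the
    preceding position of the diagonal would otherwise belong to T as well.\<close>
  have a_0: "a 0 = a0"
  proof -
    have "\<not> x \<lless> (i, j)" if "x \<in> G" for x
    proof
      assume x: "x \<lless> (i, j)"
      obtain x1 x2 where x_eq: "x = (x1, x2)" by (cases x)
      have xT: "(x1, x2) \<in> T" using that GT x_eq by auto
      then have x1: "1 \<le> x1" "1 \<le> x2" using T V by auto
      have le: "x1 \<le> i - 1" "x2 \<le> j - 1" using x x_eq by (auto simp: strictly_southeast_def)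
      have "(i - 1, j - 1) \<in> V" by (rule full) (use x1 le ij in auto)
      then have "(i - 1, j - 1) \<in> T"
        using final[OF xT] xT le by (cases "(x1, x2) = (i - 1, j - 1)") auto
      then have "i \<le> i - 1" by (rule first(2)) (use ij x1 le in auto)
      then show False using ij by simp
    qed
    then have "{p \<in> F. p \<lless> q 0} = {p \<in> F0. p \<lless> (i, j)}" by (auto simp: F_def q_def)
    then show ?thesis by (simp add: a_def a0)
  qed
  have a_mono: "a t \<le> a (Suc t)" for t
    unfolding a_def by (rule height_mono) (use fF in \<open>auto simp: q_def strictly_southeast_def\<close>)
  have a_Suc_le: "a (Suc t) \<le> Suc (a t)" for t
    using height_corner_Suc_le[OF fF, of "i + t" "j + t"] by (simp add: a_def q_def)
  have step: "a (Suc t) = a t + (if q t \<in> F then 1 else 0)" if t: "t < l" for t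
  proof (cases "q t \<in> F")
    case True
    have "height {p \<in> F. p \<lless> q t} + height {q t} \<le> height {p \<in> F. p \<lless> q (Suc t)}"
      using True fF by (intro height_add_le) (auto simp: q_def strictly_southeast_def)
    then show ?thesis using a_Suc_le[of t] True by (simp add: a_def height_singleton)
  next
    case False
    have "r \<le> a t + 1 + height {p \<in> F. q t \<lless> p}"
      using facet_blocked[OF fT fF0 G qT[OF t]] False by (auto simp: a_def F_def)
    moreover have "a (Suc t) + height {p \<in> F. q t \<lless> p} \<le> height F"
      unfolding a_def using fF
      by (intro height_add_le) (auto simp: q_def strictly_southeast_def)
    ultimately have "a (Suc t) \<le> a t" using hF by linarith
    then show ?thesis using a_mono[of t] False by simp
  qed
  define K where "K = {t. t < l \<and> q t \<in> F}"
  have a_l: "a l = a0 + card K"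
    using increment_count[of l a "\<lambda>t. q t \<in> F"] step a_0 by (simp add: K_def)
  have "card K \<le> card {..<l}" unfolding K_def by (rule card_mono) auto
  then have up1: "a l \<le> a0 + l" using a_l by simp
  have "a l \<le> height F" unfolding a_def by (rule height_mono) (use fF in auto)
  then have up2: "a l \<le> r - 1" using hF by simp
  have low: "min (r - 1) (a0 + l) \<le> a l"
  proof (cases "\<forall>t<l. q t \<in> F")
    case True
    then have "K = {..<l}" by (auto simp: K_def)
    then show ?thesis using a_l by simp
  next
    case False
    \<comment> \<open>Beyond the last missing position of the diagonal every position belongs to F, and no
      chain in the remaining rows or columns is longer than this tail of the diagonal.\<close>
    define t where "t = Max {t. t < l \<and> q t \<notin> F}"
    have "t \<in> {t. t < l \<and> q t \<notin> F}" unfolding t_def by (rule Max_in) (use False in auto)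
    then have t: "t < l" "q t \<notin> F" by auto
    have later: "q u \<in> F" if "u < l" "t < u" for u
    proof (rule ccontr)
      assume "q u \<notin> F"
      then have "u \<le> t" unfolding t_def using that by (intro Max_ge) auto
      then show False using that by simp
    qed
    have tail: "u + Suc t \<le> l \<Longrightarrow> a (u + Suc t) = a t + u" for u
    proof (induction u)
      case 0 then show ?case using step[OF t(1)] t(2) by simp
    next
      case (Suc u)
      then show ?case using step[of "u + Suc t"] later[of "u + Suc t"] by simp
    qed
    have al: "a l = a t + (l - Suc t)" using tail[of "l - Suc t"] t by simp
    have "r \<le> a t + 1 + height {p \<in> F. q t \<lless> p}"
      using facet_blocked[OF fT fF0 G qT[OF t(1)]] t(2) by (auto simp: a_def F_def)
    moreover have "height {p \<in> F. q t \<lless> p} \<le> card {i + t<..n}"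
      by (rule height_le_card_rows) (use fF FV V in \<open>auto simp: q_def strictly_southeast_def\<close>)
    moreover have "height {p \<in> F. q t \<lless> p} \<le> card {j + t<..m}"
      by (rule height_le_card_columns) (use fF FV V in \<open>auto simp: q_def strictly_southeast_def\<close>)
    ultimately have "r \<le> a t + 1 + (l - Suc t)" using l by auto
    then show ?thesis using al by simp
  qed
  have "bij_betw q K {v \<in> G. int (snd v) - int (fst v) = int j - int i}"
  proof (rule bij_betwI')
    fix x y show "(q x = q y) = (x = y)" by (auto simp: q_def)
  next
    fix x assume "x \<in> K"
    then show "q x \<in> {v \<in> G. int (snd v) - int (fst v) = int j - int i}"
      using qT F0 by (auto simp: K_def F_def q_def)
  next
    fix y assume "y \<in> {v \<in> G. int (snd v) - int (fst v) = int j - int i}"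
    then obtain y1 y2 where y: "y = (y1, y2)" "(y1, y2) \<in> G" "int y2 - int y1 = int j - int i"
      by (cases y) auto
    have "(y1, y2) \<in> T" using y GT by auto
    then have "i \<le> y1" "y1 \<le> n" "y2 \<le> m" using first(2) y T V by auto
    then have "y1 - i < l" "y = q (y1 - i)" using y l by (auto simp: q_def)
    then show "\<exists>x\<in>K. y = q x" using y by (auto simp: K_def F_def)
  qed
  then have "card K = card {v \<in> G. int (snd v) - int (fst v) = int j - int i}"
    by (rule bij_betw_same_card)
  then show ?thesis using a_l up1 up2 low by linarith
qed

text \<open>
  The size of a facet is the sum of its counts along the diagonals. By the hypothesis on V, no
  position on a diagonal with zeros lies on a chain of r positions, so a facet contains all positions
  of T on that diagonal; the other diagonals are covered by \<open>facet_diagonal_count\<close>.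
\<close>
lemma pure_chain_complex:
  assumes V: "V \<subseteq> {1..n} \<times> {1..m}" and T: "T \<subseteq> V"
    and final: "\<And>p q. p \<in> T \<Longrightarrow> q \<in> V \<Longrightarrow> p < q \<Longrightarrow> q \<in> T"
    and F0: "F0 \<subseteq> V - T"
    and diag: "\<And>v w. v \<in> V \<Longrightarrow> w \<in> {1..n} \<times> {1..m} - V \<Longrightarrow>
        int (snd v) - int (fst v) = int (snd w) - int (fst w) \<Longrightarrow>
        height {p \<in> V. p \<lless> v} + 1 + height {p \<in> V. v \<lless> p} < r"
  shows "pure (chain_complex r T F0)"
  unfolding pure_def
proof (intro ballI)
  fix G H
  assume G: "G \<in> facets (chain_complex r T F0)" and H: "H \<in> facets (chain_complex r T F0)"
  define c where "c v = int (snd v) - int (fst v)" for v :: position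
  have fV: "finite V" using V finite_subset by blast
  then have fT: "finite T" and fF0: "finite F0" using T F0 finite_subset by blast+
  have sub: "K \<subseteq> T" if "K \<in> facets (chain_complex r T F0)" for K
    using that by (auto simp: facets_def chain_complex_def)
  have same: "card {v \<in> G. c v = d} = card {v \<in> H. c v = d}" if "d \<in> c ` T" for d
  proof (cases "\<forall>w \<in> {1..n} \<times> {1..m}. c w = d \<longrightarrow> w \<in> V")
    case True
    define D where "D = {v \<in> T. c v = d}"
    have ne: "D \<noteq> {}" using that by (auto simp: D_def)
    have fin: "finite D" using fT by (simp add: D_def)
    define i where "i = Min (fst ` D)"
    have "i \<in> fst ` D" unfolding i_def by (rule Min_in) (use fin ne in auto)
    then obtain j where "(i, j) \<in> D" by auto
    then have j: "(i, j) \<in> T" "c (i, j) = d" by (auto simp: D_def)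
    have first: "i \<le> i'" if "(i', j') \<in> T" "c (i', j') = d" for i' j'
    proof -
      have "(i', j') \<in> D" using that by (simp add: D_def)
      then have "fst (i', j') \<in> fst ` D" by (rule imageI)
      then have "Min (fst ` D) \<le> fst (i', j')" using fin by (intro Min_le) auto
      then show ?thesis by (simp add: i_def)
    qed
    have d: "d = int j - int i" using j by (simp add: c_def)
    have "card {v \<in> K. int (snd v) - int (fst v) = int j - int i} + height {p \<in> F0. p \<lless> (i, j)}
       = min (r - 1) (height {p \<in> F0. p \<lless> (i, j)} + Suc (min (n - i) (m - j)))"
      if K: "K \<in> facets (chain_complex r T F0)" for K
    proof (rule facet_diagonal_count[OF V T _ F0 K j(1) _ _ refl refl])
      show "q \<in> T" if "p \<in> T" "q \<in> V" "p < q" for p q using that by (rule final)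
      show "i \<le> i'" if "(i', j') \<in> T" "int j' - int i' = int j - int i" for i' j'
        by (rule first[OF that(1)]) (simp add: c_def d that(2))
      show "(i', j') \<in> V" if "(i', j') \<in> {1..n} \<times> {1..m}" "int j' - int i' = int j - int i"
        for i' j'
        using True that by (simp add: c_def d)
    qed
    from this[OF G] this[OF H] show ?thesis by (simp add: c_def d)
  next
    case False
    then obtain w where w: "w \<in> {1..n} \<times> {1..m} - V" "c w = d" by auto
    have "{v \<in> K. c v = d} = {v \<in> T. c v = d}" if K: "K \<in> facets (chain_complex r T F0)" for K
    proof -
      have "v \<in> K" if v: "v \<in> T" "c v = d" for v
      proof (rule ccontr)
        assume "v \<notin> K"
        then have "r \<le> height {p \<in> F0 \<union> K. p \<lless> v} + 1 + height {p \<in> F0 \<union> K. v \<lless> p}"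
          using facet_blocked[OF fT fF0 K] v by blast
        moreover have "F0 \<union> K \<subseteq> V" using F0 sub[OF K] T by auto
        then have "height {p \<in> F0 \<union> K. p \<lless> v} \<le> height {p \<in> V. p \<lless> v}"
          "height {p \<in> F0 \<union> K. v \<lless> p} \<le> height {p \<in> V. v \<lless> p}"
          using fV by (auto intro!: height_mono)
        moreover have "height {p \<in> V. p \<lless> v} + 1 + height {p \<in> V. v \<lless> p} < r"
          using diag[of v w] v w T by (auto simp: c_def)
        ultimately show False by linarith
      qed
      then show ?thesis using sub[OF K] by auto
    qed
    then show ?thesis using G H by simp
  qed
  have total: "card K = (\<Sum>d\<in>c ` T. card {v \<in> K. c v = d})"
    if K: "K \<in> facets (chain_complex r T F0)" for K
  proof -
    have fK: "finite K" using sub[OF K] fT finite_subset by blast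
    have "K = (\<Union>d\<in>c ` T. {v \<in> K. c v = d})" using sub[OF K] by auto
    then have "card K = card (\<Union>d\<in>c ` T. {v \<in> K. c v = d})" by simp
    also have "\<dots> = (\<Sum>d\<in>c ` T. card {v \<in> K. c v = d})"
      by (rule card_UN_disjoint) (use fT fK in auto)
    finally show ?thesis .
  qed
  show "card G = card H" unfolding total[OF G] total[OF H] using same by (rule sum.cong[OF refl])
qed

lemma simplicial_chain_complex:
  assumes "finite T" "finite F0" "height F0 < r"
  shows "simplicial_complex (chain_complex r T F0)"
  unfolding simplicial_complex_def
proof (intro conjI ballI allI impI)
  have "{} \<in> chain_complex r T F0" using assms by (simp add: chain_complex_def)
  then show "chain_complex r T F0 \<noteq> {}" by blast
  show "finite (\<Union> (chain_complex r T F0))"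
    by (rule finite_subset[OF _ assms(1)]) (auto simp: chain_complex_def)
next
  fix F G assume F: "F \<in> chain_complex r T F0" "G \<subseteq> F"
  then have "finite (F0 \<union> F)" using assms finite_subset by (auto simp: chain_complex_def)
  then have "height (F0 \<union> G) \<le> height (F0 \<union> F)" using F by (intro height_mono) auto
  then show "G \<in> chain_complex r T F0" using F by (auto simp: chain_complex_def)
qed




text \<open>
  The least position v of T is shed. The rest of T is again a final segment of V, the deletion keeps
  F0 and the link adds v to it. If v together with F0 already has too long a chain, v is not a vertex
  and can be dropped from T.
\<close>
lemma vertex_decomposable_chain_complex:
  assumes V: "V \<subseteq> {1..n} \<times> {1..m}" and T: "T \<subseteq> V"
    and final: "\<And>p q. p \<in> T \<Longrightarrow> q \<in> V \<Longrightarrow> p < q \<Longrightarrow> q \<in> T"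
    and F0: "F0 \<subseteq> V - T" "height F0 < r"
    and diag: "\<And>v w. v \<in> V \<Longrightarrow> w \<in> {1..n} \<times> {1..m} - V \<Longrightarrow>
        int (snd v) - int (fst v) = int (snd w) - int (fst w) \<Longrightarrow>
        height {p \<in> V. p \<lless> v} + 1 + height {p \<in> V. v \<lless> p} < r"
  shows "vertex_decomposable (chain_complex r T F0)"
proof -
  have fV: "finite V" using V by (rule finite_subset) simp
  show ?thesis using T final F0
  proof (induction "card T" arbitrary: T F0)
    case 0
    then have "T = {}" using finite_subset[OF 0(2) fV] by simp
    then have "chain_complex r T F0 = {{}}" using 0(5) by (auto simp: chain_complex_def)
    then show ?case by (simp add: vertex_decomposable.empty_face)
  next
    case (Suc k)
    note TV = Suc.prems(1) and fin = Suc.prems(2) and F0T = Suc.prems(3) and hF0 = Suc.prems(4)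
    have fT: "finite T" using TV fV by (rule finite_subset)
    have fF0: "finite F0" using F0T fV by (auto intro: finite_subset)
    define v where "v = Min T"
    have ne: "T \<noteq> {}" using Suc.hyps by auto
    have v: "v \<in> T" unfolding v_def using fT ne by (rule Min_in)
    have v_le: "v \<le> p" if "p \<in> T" for p unfolding v_def using fT that by (rule Min_le)
    have k: "k = card (T - {v})" using Suc.hyps(2) v by simp
    have TV': "T - {v} \<subseteq> V" using TV by auto
    have fin': "q \<in> T - {v}" if "p \<in> T - {v}" "q \<in> V" "p < q" for p q
    proof -
      have "v < q" using v_le[of p] that by auto
      then show ?thesis using fin[of p q] that by auto
    qed
    have F0': "F0 \<subseteq> V - (T - {v})" "insert v F0 \<subseteq> V - (T - {v})" using F0T TV v by auto
    have del: "vertex_decomposable (chain_complex r (T - {v}) F0)"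
      by (rule Suc.hyps(1)[OF k TV' fin' F0'(1) hF0])
    have mono: "height (F0 \<union> G) < r" if "G \<subseteq> H" "H \<subseteq> T" "height (insert v (F0 \<union> H)) < r" for G H
    proof -
      have "finite (insert v (F0 \<union> H))" using fF0 finite_subset[OF that(2) fT] by simp
      then have "height (F0 \<union> G) \<le> height (insert v (F0 \<union> H))"
        by (rule height_mono) (use that(1) in auto)
      then show ?thesis using that(3) by simp
    qed
    show ?case
    proof (cases "height (insert v F0) < r")
      case True
      have lk: "vertex_decomposable (chain_complex r (T - {v}) (insert v F0))"
        by (rule Suc.hyps(1)[OF k TV' fin' F0'(2) True])
      have del_eq: "deletion v (chain_complex r T F0) = chain_complex r (T - {v}) F0"
        by (auto simp: deletion_def chain_complex_def)
      have link_eq: "link v (chain_complex r T F0) = chain_complex r (T - {v}) (insert v F0)"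
        using v mono[OF order_refl] by (auto simp: link_def chain_complex_def)
      show ?thesis
      proof (rule vertex_decomposable.decompose)
        show "simplicial_complex (chain_complex r T F0)"
          by (rule simplicial_chain_complex[OF fT fF0 hF0])
        show "pure (chain_complex r T F0)"
          by (rule pure_chain_complex[OF V TV fin F0T diag])
        show "{v} \<in> chain_complex r T F0" using v True by (simp add: chain_complex_def)
        show "vertex_decomposable (deletion v (chain_complex r T F0))"
          unfolding del_eq by (rule del)
        show "vertex_decomposable (link v (chain_complex r T F0))"
          unfolding link_eq by (rule lk)
      qed
    next
      case False
      have "v \<notin> G" if "G \<subseteq> T" "height (F0 \<union> G) < r" for G
      proof
        assume "v \<in> G"
        have "finite (F0 \<union> G)" using fF0 finite_subset[OF that(1) fT] by simp
        then have "height (insert v F0) \<le> height (F0 \<union> G)"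
          by (rule height_mono) (use \<open>v \<in> G\<close> in auto)
        then show False using that(2) False by simp
      qed
      then have "chain_complex r T F0 = chain_complex r (T - {v}) F0"
        by (auto simp: chain_complex_def)
      then show ?thesis using del by simp
    qed
  qed
qed


section \<open>Leading coefficients\<close>

text \<open>
  The exponents of f are bounded by d, and c is the coefficient at d. The value c = 0 is allowed and
  says that d is a strict bound; this makes the notion compatible with sums over terms of which only
  some attain the bound.
\<close>
definition leads :: "('g::linorder \<Rightarrow>\<^sub>0 'b::zero) \<Rightarrow> 'g \<Rightarrow> 'b \<Rightarrow> bool" where
  "leads f d c \<longleftrightarrow> (\<forall>k\<in>Poly_Mapping.keys f. k \<le> d) \<and> Poly_Mapping.lookup f d = c"

lemma leads_key_le: "leads f d c \<Longrightarrow> Poly_Mapping.lookup f k \<noteq> 0 \<Longrightarrow> k \<le> d"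
  by (simp add: leads_def in_keys_iff)

lemma leads_0: "leads 0 d 0"
  by (simp add: leads_def)

lemma leads_single: "leads (Poly_Mapping.single d c) d c"
  by (auto simp: leads_def)

lemma leads_single_less: "d < d' \<Longrightarrow> leads (Poly_Mapping.single d c) d' 0"
  by (auto simp: leads_def lookup_single when_def)

lemma leads_less: "leads f d c \<Longrightarrow> d < d' \<Longrightarrow> leads f d' 0"
  unfolding leads_def by (meson in_keys_iff leD less_imp_le order.trans)

lemma leads_add: "leads f d b \<Longrightarrow> leads g d c \<Longrightarrow> leads (f + g) d (b + c)"
  unfolding leads_def using keys_add[of f g] by (auto simp: lookup_add)

lemma leads_sum:
  assumes "\<And>x. x \<in> S \<Longrightarrow> leads (f x) d (c x)"
  shows "leads (\<Sum>x\<in>S. f x) d (\<Sum>x\<in>S. c x)"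
  using assms by (induction S rule: infinite_finite_induct) (auto simp: leads_0 leads_add)

text \<open>
  Split off the terms at d and e: every other product of terms has a strictly smaller exponent.
\<close>
lemma leads_mult:
  fixes f g :: "'g::{ordered_cancel_comm_monoid_add, linorder} \<Rightarrow>\<^sub>0 'b::comm_ring_1"
  assumes "leads f d b" "leads g e c"
  shows "leads (f * g) (d + e) (b * c)"
proof -
  define f' where "f' = f - Poly_Mapping.single d b"
  define g' where "g' = g - Poly_Mapping.single e c"
  have f': "k < d" if "k \<in> Poly_Mapping.keys f'" for k
  proof -
    have "k \<noteq> d" using that assms(1) by (auto simp: f'_def leads_def in_keys_iff lookup_minus)
    moreover from this have "Poly_Mapping.lookup f k \<noteq> 0"
      using that by (auto simp: f'_def in_keys_iff lookup_minus lookup_single)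
    ultimately show ?thesis using leads_key_le[OF assms(1)] by (simp add: less_le)
  qed
  have g': "k < e" if "k \<in> Poly_Mapping.keys g'" for k
  proof -
    have "k \<noteq> e" using that assms(2) by (auto simp: g'_def leads_def in_keys_iff lookup_minus)
    moreover from this have "Poly_Mapping.lookup g k \<noteq> 0"
      using that by (auto simp: g'_def in_keys_iff lookup_minus lookup_single)
    ultimately show ?thesis using leads_key_le[OF assms(2)] by (simp add: less_le)
  qed
  have low1: "k < d + e" if "k \<in> Poly_Mapping.keys (f' * g)" for k
  proof -
    obtain x y where "k = x + y" "x \<in> Poly_Mapping.keys f'" "y \<in> Poly_Mapping.keys g"
      using \<open>k \<in> _\<close> keys_mult[of f' g] by blast
    then show ?thesis using f' assms(2) by (auto simp: leads_def intro: add_less_le_mono)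
  qed
  have low2: "k < d + e" if "k \<in> Poly_Mapping.keys (Poly_Mapping.single d b * g')" for k
  proof -
    obtain x y where "k = x + y" "x \<in> Poly_Mapping.keys (Poly_Mapping.single d b)"
        "y \<in> Poly_Mapping.keys g'"
      using \<open>k \<in> _\<close> keys_mult[of "Poly_Mapping.single d b" g'] by blast
    then show ?thesis using g' by (auto simp: add_strict_left_mono split: if_splits)
  qed
  have "leads (f' * g) (d + e) 0"
    using low1 unfolding leads_def by (auto simp: in_keys_iff less_imp_le)
  moreover have "leads (Poly_Mapping.single d b * g') (d + e) 0"
    using low2 unfolding leads_def by (auto simp: in_keys_iff less_imp_le)
  moreover have "leads (Poly_Mapping.single d b * Poly_Mapping.single e c) (d + e) (b * c)"
    by (simp add: mult_single leads_single)
  moreover have "f * g = f' * g + Poly_Mapping.single d b * g'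
      + Poly_Mapping.single d b * Poly_Mapping.single e c"
    by (simp add: f'_def g'_def algebra_simps)
  ultimately show ?thesis by (metis leads_add add_0)
qed

lemma leads_1: "leads (1 :: 'g::{zero, linorder} \<Rightarrow>\<^sub>0 'b::comm_ring_1) 0 1"
  using leads_single[of "0::'g" "1::'b"] by simp

lemma leads_prod:
  fixes f :: "'i \<Rightarrow> ('g::{ordered_cancel_comm_monoid_add, linorder} \<Rightarrow>\<^sub>0 'b::comm_ring_1)"
  assumes "\<And>x. x \<in> S \<Longrightarrow> leads (f x) (d x) (c x)"
  shows "leads (\<Prod>x\<in>S. f x) (\<Sum>x\<in>S. d x) (\<Prod>x\<in>S. c x)"
  using assms by (induction S rule: infinite_finite_induct) (auto simp: leads_1 leads_mult)

lemma leads_power_single: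
  fixes f :: "(position \<Rightarrow>\<^sub>0 int) \<Rightarrow>\<^sub>0 'b::comm_ring_1"
  assumes "leads f (Poly_Mapping.single v 1) c"
  shows "leads (f ^ k) (Poly_Mapping.single v (int k)) (c ^ k)"
proof (induction k)
  case (Suc k)
  have "Poly_Mapping.single v (int (Suc k)) = Poly_Mapping.single v 1 + Poly_Mapping.single v (int k)"
    by (simp add: single_add[symmetric])
  then show ?case using leads_mult[OF assms Suc] by simp
qed (simp add: leads_1)


section \<open>Substitution\<close>

definition monom_value :: "(position \<Rightarrow> 'b::comm_ring_1) \<Rightarrow> monom \<Rightarrow> 'b" where
  "monom_value M u = (\<Prod>v\<in>Poly_Mapping.keys u. M v ^ Poly_Mapping.lookup u v)"

text \<open>
  The value of a polynomial at a matrix M of elements of the monoid algebra over k. With exponents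
  from a group these elements are Laurent polynomials.
\<close>
definition substitute ::
    "(position \<Rightarrow> ('g::comm_monoid_add \<Rightarrow>\<^sub>0 'k::field)) \<Rightarrow> 'k entry_poly \<Rightarrow> ('g \<Rightarrow>\<^sub>0 'k)" where
  "substitute M f =
     (\<Sum>u\<in>Poly_Mapping.keys f. Poly_Mapping.single 0 (Poly_Mapping.lookup f u) * monom_value M u)"

lemma monom_value_superset:
  "finite S \<Longrightarrow> Poly_Mapping.keys u \<subseteq> S \<Longrightarrow> monom_value M u = (\<Prod>v\<in>S. M v ^ Poly_Mapping.lookup u v)"
  unfolding monom_value_def by (rule prod.mono_neutral_left) (auto simp: in_keys_iff)

lemma monom_value_add: "monom_value M (u + w) = monom_value M u * monom_value M w"
proof -
  have "Poly_Mapping.keys (u + w) \<subseteq> Poly_Mapping.keys u \<union> Poly_Mapping.keys w" by (rule keys_add)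
  then show ?thesis
    by (simp add: monom_value_superset[of "Poly_Mapping.keys u \<union> Poly_Mapping.keys w"]
        lookup_add power_add prod.distrib)
qed

lemma monom_value_0 [simp]: "monom_value M 0 = 1"
  by (simp add: monom_value_def)

lemma monom_value_single [simp]: "monom_value M (Poly_Mapping.single v 1) = M v"
  by (simp add: monom_value_def)

lemma substitute_superset:
  "finite S \<Longrightarrow> Poly_Mapping.keys f \<subseteq> S \<Longrightarrow> substitute M f =
     (\<Sum>u\<in>S. Poly_Mapping.single 0 (Poly_Mapping.lookup f u) * monom_value M u)"
  unfolding substitute_def by (rule sum.mono_neutral_left) (auto simp: in_keys_iff)

lemma substitute_add: "substitute M (f + g) = substitute M f + substitute M g"
proof -
  have "Poly_Mapping.keys (f + g) \<subseteq> Poly_Mapping.keys f \<union> Poly_Mapping.keys g" by (rule keys_add)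
  then show ?thesis
    by (simp add: substitute_superset[of "Poly_Mapping.keys f \<union> Poly_Mapping.keys g"]
        lookup_add single_add distrib_right sum.distrib)
qed

lemma substitute_single:
  "substitute M (Poly_Mapping.single u c) = Poly_Mapping.single 0 c * monom_value M u"
  by (cases "c = 0") (simp_all add: substitute_def)

lemma substitute_0 [simp]: "substitute M 0 = 0"
  by (simp add: substitute_def)

lemma substitute_sum: "substitute M (\<Sum>x\<in>S. f x) = (\<Sum>x\<in>S. substitute M (f x))"
  by (induction S rule: infinite_finite_induct) (auto simp: substitute_add)

lemma sum_of_terms:
  "f = (\<Sum>u\<in>Poly_Mapping.keys f. Poly_Mapping.single u (Poly_Mapping.lookup f u))"
proof (rule poly_mapping_eqI)
  fix k
  show "Poly_Mapping.lookup f k = Poly_Mapping.lookup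
      (\<Sum>u\<in>Poly_Mapping.keys f. Poly_Mapping.single u (Poly_Mapping.lookup f u)) k"
    by (auto simp: lookup_sum lookup_single when_def in_keys_iff)
qed

lemma substitute_mult:
  fixes M :: "position \<Rightarrow> ('a::comm_monoid_add \<Rightarrow>\<^sub>0 'b::field)"
  shows "substitute M (f * g) = substitute M f * substitute M g"
proof -
  let ?K = "Poly_Mapping.keys" and ?L = "Poly_Mapping.lookup"
  have const: "Poly_Mapping.single (0::'a) (x * y) = Poly_Mapping.single 0 x * Poly_Mapping.single 0 y"
    for x y :: 'b
    using mult_single[of "0::'a" x 0 y] by simp
  have "f * g = (\<Sum>u\<in>?K f. \<Sum>w\<in>?K g. Poly_Mapping.single (u + w) (?L f u * ?L g w))"
    by (subst sum_of_terms[of f], subst sum_of_terms[of g]) (simp add: sum_product mult_single)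
  then have "substitute M (f * g)
      = (\<Sum>u\<in>?K f. \<Sum>w\<in>?K g. Poly_Mapping.single 0 (?L f u * ?L g w) * monom_value M (u + w))"
    by (simp add: substitute_sum substitute_single)
  also have "\<dots> = substitute M f * substitute M g"
    unfolding substitute_def sum_product
    by (intro sum.cong refl) (simp add: monom_value_add const ac_simps)
  finally show ?thesis .
qed

lemma substitute_1 [simp]: "substitute M 1 = 1"
  using substitute_single[of M 0 1] by simp

lemma substitute_indet [simp]: "substitute M (indet v) = M v"
  by (simp add: indet_def power_product_def substitute_single del: One_nat_def)

interpretation substitute: comm_ring_hom "substitute M"
  for M :: "position \<Rightarrow> ('g::comm_monoid_add \<Rightarrow>\<^sub>0 'k::field)"
  by unfold_locales (simp_all add: substitute_add substitute_mult)


section \<open>Rank-one matrices with prescribed exponents\<close>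

text \<open>
  Induction on the size of the rectangle, with a construction in which the northeast corner
  \<open>(i0, j1)\<close> always attains its bound. An antichain cannot meet both the rest of row i0 and the rest of column j1, so
  one of the two can be split off: the new value of \<open>\<alpha>\<close> or \<open>\<beta>\<close> is then dictated by the corner,
  and the remaining bounds in the new row or column follow from those in the neighbouring one by the
  inequality for \<open>2 \<times> 2\<close> blocks.
\<close>
lemma rank_one_weights:
  fixes e :: "nat \<Rightarrow> nat \<Rightarrow> 'g::linordered_ab_group_add"
  assumes "i0 \<le> i1" "j0 \<le> j1"
    and super: "\<And>i i' j j'. i0 \<le> i \<Longrightarrow> i < i' \<Longrightarrow> i' \<le> i1 \<Longrightarrow> j0 \<le> j \<Longrightarrow> j < j' \<Longrightarrow> j' \<le> j1 \<Longrightarrow>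
        e i j' + e i' j \<le> e i j + e i' j'"
    and antichain: "\<And>p q. p \<in> A \<Longrightarrow> q \<in> A \<Longrightarrow> \<not> p \<lless> q"
  shows "\<exists>\<alpha> \<beta>. (\<forall>i\<in>{i0..i1}. \<forall>j\<in>{j0..j1}. \<alpha> i + \<beta> j \<le> e i j) \<and>
      (\<forall>i\<in>{i0..i1}. \<forall>j\<in>{j0..j1}. (i, j) \<in> A \<longrightarrow> \<alpha> i + \<beta> j = e i j) \<and>
      \<alpha> i0 + \<beta> j1 = e i0 j1"
  using assms(1-3)
proof (induction "(i1 - i0) + (j1 - j0)" arbitrary: i0 j1)
  case 0
  then have eq: "i0 = i1" "j0 = j1" by auto
  show ?case by (rule exI[of _ "\<lambda>_. 0"], rule exI[of _ "\<lambda>_. e i0 j1"]) (auto simp: eq)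
next
  case (Suc k)
  note super = Suc.prems(3)
  consider (row) "i0 < i1" "\<forall>j\<in>{j0..<j1}. (i0, j) \<notin> A"
    | (column) "j0 < j1" "\<forall>i\<in>{i0<..i1}. (i, j1) \<notin> A"
  proof (cases "i0 < i1 \<and> (\<forall>j\<in>{j0..<j1}. (i0, j) \<notin> A)")
    case False
    have "j0 < j1" using False Suc.hyps(2) Suc.prems(1,2) by (cases "i0 < i1") auto
    moreover have "(i, j1) \<notin> A" if i: "i \<in> {i0<..i1}" for i
    proof
      assume "(i, j1) \<in> A"
      moreover obtain j where "j \<in> {j0..<j1}" "(i0, j) \<in> A" using False i by auto
      ultimately show False
        using antichain[of "(i0, j)" "(i, j1)"] i by (auto simp: strictly_southeast_def)
    qed
    ultimately show ?thesis using that(2) by blast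
  qed (use that(1) in blast)
  then show ?case
  proof cases
    case row
    obtain \<alpha> \<beta> where le: "\<And>i j. i \<in> {Suc i0..i1} \<Longrightarrow> j \<in> {j0..j1} \<Longrightarrow> \<alpha> i + \<beta> j \<le> e i j"
      and eq: "\<And>i j. i \<in> {Suc i0..i1} \<Longrightarrow> j \<in> {j0..j1} \<Longrightarrow> (i, j) \<in> A \<Longrightarrow> \<alpha> i + \<beta> j = e i j"
      and corner: "\<alpha> (Suc i0) + \<beta> j1 = e (Suc i0) j1"
    proof -
      have "k = (i1 - Suc i0) + (j1 - j0)" using Suc.hyps(2) Suc.prems(2) row(1) by simp
      from Suc.hyps(1)[OF this] show thesis
        using that Suc.prems(2) super row(1) by (metis Suc_leD Suc_leI)
    qed
    have new: "e i0 j1 - \<beta> j1 + \<beta> j \<le> e i0 j" if j: "j \<in> {j0..<j1}" for j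
    proof -
      have "\<alpha> (Suc i0) + (e i0 j1 + \<beta> j) = e i0 j1 + (\<alpha> (Suc i0) + \<beta> j)" by (simp add: ac_simps)
      also have "\<dots> \<le> e i0 j1 + e (Suc i0) j"
        using le[of "Suc i0" j] row(1) j by (intro add_left_mono) auto
      also have "\<dots> \<le> e i0 j + e (Suc i0) j1" by (rule super) (use row(1) j in auto)
      also have "\<dots> = \<alpha> (Suc i0) + (e i0 j + \<beta> j1)" by (simp add: corner[symmetric] ac_simps)
      finally have "e i0 j1 + \<beta> j \<le> e i0 j + \<beta> j1" by simp
      then show ?thesis by (simp add: algebra_simps)
    qed
    show ?thesis
    proof (rule exI[of _ "\<alpha>(i0 := e i0 j1 - \<beta> j1)"], rule exI[of _ \<beta>], intro conjI ballI impI)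
      fix i j assume i: "i \<in> {i0..i1}" and j: "j \<in> {j0..j1}"
      show "(\<alpha>(i0 := e i0 j1 - \<beta> j1)) i + \<beta> j \<le> e i j"
        using new[of j] le[of i j] i j by (cases "i = i0"; cases "j = j1") auto
      show "(\<alpha>(i0 := e i0 j1 - \<beta> j1)) i + \<beta> j = e i j" if "(i, j) \<in> A"
        using that row(2) eq[of i j] i j by (cases "i = i0"; cases "j = j1") auto
    qed simp
  next
    case column
    obtain j2 where j2: "j1 = Suc j2" using column(1) by (cases j1) auto
    obtain \<alpha> \<beta> where le: "\<And>i j. i \<in> {i0..i1} \<Longrightarrow> j \<in> {j0..j2} \<Longrightarrow> \<alpha> i + \<beta> j \<le> e i j"
      and eq: "\<And>i j. i \<in> {i0..i1} \<Longrightarrow> j \<in> {j0..j2} \<Longrightarrow> (i, j) \<in> A \<Longrightarrow> \<alpha> i + \<beta> j = e i j"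
      and corner: "\<alpha> i0 + \<beta> j2 = e i0 j2"
    proof -
      have "k = (i1 - i0) + (j2 - j0)" "j0 \<le> j2" using Suc.hyps(2) column(1) j2 by auto
      from Suc.hyps(1)[OF this(1) Suc.prems(1) this(2)] show thesis
        using that super j2 by (metis le_SucI)
    qed
    have new: "\<alpha> i + (e i0 j1 - \<alpha> i0) \<le> e i j1" if i: "i \<in> {i0<..i1}" for i
    proof -
      have "\<beta> j2 + (\<alpha> i + e i0 j1) = e i0 j1 + (\<alpha> i + \<beta> j2)" by (simp add: ac_simps)
      also have "\<dots> \<le> e i0 j1 + e i j2"
        using le[of i j2] column(1) i j2 by (intro add_left_mono) auto
      also have "\<dots> \<le> e i0 j2 + e i j1" by (rule super) (use column(1) i j2 in auto)
      also have "\<dots> = \<beta> j2 + (\<alpha> i0 + e i j1)" by (simp add: corner[symmetric] ac_simps)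
      finally have "\<alpha> i + e i0 j1 \<le> \<alpha> i0 + e i j1" by simp
      then show ?thesis by (simp add: algebra_simps)
    qed
    show ?thesis
    proof (rule exI[of _ \<alpha>], rule exI[of _ "\<beta>(j1 := e i0 j1 - \<alpha> i0)"], intro conjI ballI impI)
      fix i j assume i: "i \<in> {i0..i1}" and j: "j \<in> {j0..j1}"
      show "\<alpha> i + (\<beta>(j1 := e i0 j1 - \<alpha> i0)) j \<le> e i j"
        using new[of i] le[of i j] i j j2 by (cases "i = i0"; cases "j = j1") auto
      show "\<alpha> i + (\<beta>(j1 := e i0 j1 - \<alpha> i0)) j = e i j" if "(i, j) \<in> A"
        using that column(2) eq[of i j] i j j2 by (cases "i = i0"; cases "j = j1") auto
    qed simp
  qed
qed


text \<open>
  If the southwest and the northeast corner of a rectangle belong to V, so does the rectangle. The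
  non-zero positions have this property: a ladder contains with a position everything beyond it
  towards its own corner of the matrix, so a zero inside the rectangle would force a zero at one of
  these two corners.
\<close>
definition sw_ne_convex :: "position set \<Rightarrow> bool" where
  "sw_ne_convex V \<longleftrightarrow>
     (\<forall>i i' j j'. (i', j) \<in> V \<longrightarrow> (i, j') \<in> V \<longrightarrow> {i..i'} \<times> {j..j'} \<subseteq> V)"

text \<open>
  A position of A in the first column and one in the last row are comparable unless one of them is
  the southwest corner of the bounding rectangle. So this corner belongs to A, and likewise the
  northeast corner.
\<close>
lemma antichain_rectangle_subset:
  assumes A: "A \<subseteq> V" "finite A" "A \<noteq> {}"
    and antichain: "\<And>p q. p \<in> A \<Longrightarrow> q \<in> A \<Longrightarrow> \<not> p \<lless> q"
    and convex: "sw_ne_convex V"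
  obtains i0 i1 j0 j1 where "i0 \<le> i1" "j0 \<le> j1" "A \<subseteq> {i0..i1} \<times> {j0..j1}"
    "{i0..i1} \<times> {j0..j1} \<subseteq> V"
proof -
  define i0 where "i0 = Min (fst ` A)"
  define i1 where "i1 = Max (fst ` A)"
  define j0 where "j0 = Min (snd ` A)"
  define j1 where "j1 = Max (snd ` A)"
  have fin: "finite (fst ` A)" "finite (snd ` A)" "fst ` A \<noteq> {}" "snd ` A \<noteq> {}" using A by auto
  have box: "i0 \<le> i \<and> i \<le> i1 \<and> j0 \<le> j \<and> j \<le> j1" if "(i, j) \<in> A" for i j
  proof -
    have "fst (i, j) \<in> fst ` A" "snd (i, j) \<in> snd ` A" using that by blast+
    then show ?thesis using fin by (auto simp: i0_def i1_def j0_def j1_def)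
  qed
  have "i0 \<in> fst ` A" "i1 \<in> fst ` A" unfolding i0_def i1_def using fin by auto
  then obtain b0 b1 where b: "(i0, b0) \<in> A" "(i1, b1) \<in> A" by auto
  have "j0 \<in> snd ` A" "j1 \<in> snd ` A" unfolding j0_def j1_def using fin by auto
  then obtain a0 a1 where a: "(a0, j0) \<in> A" "(a1, j1) \<in> A" by auto
  have "\<not> (a0, j0) \<lless> (i1, b1)" "\<not> (i0, b0) \<lless> (a1, j1)" using antichain a b by blast+
  then have "a0 = i1 \<or> b1 = j0" "b0 = j1 \<or> a1 = i0"
    using box[OF a(1)] box[OF b(2)] box[OF a(2)] box[OF b(1)] by (auto simp: strictly_southeast_def)
  then have sw: "(i1, j0) \<in> V" and ne: "(i0, j1) \<in> V" using a b A(1) by auto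
  show thesis
  proof
    show "i0 \<le> i1" "j0 \<le> j1" using box[OF b(1)] box[OF a(1)] by auto
    show "A \<subseteq> {i0..i1} \<times> {j0..j1}" using box by auto
    show "{i0..i1} \<times> {j0..j1} \<subseteq> V" using convex sw ne by (simp add: sw_ne_convex_def)
  qed
qed

text \<open>
  The bounds e for \<open>rank_one_weights\<close> are the indeterminates themselves at positions of A, and
  lowered by a tiny amount eps at all other positions; there the entry then stays strictly below the
  indeterminate. A \<open>2 \<times> 2\<close> block satisfies the required inequality because its northwest position is
  lexicographically first and decides the comparison.
\<close>
lemma rank_one_layer:
  assumes V: "V \<subseteq> {1..n} \<times> {1..m}" and A: "A \<subseteq> V"
    and antichain: "\<And>p q. p \<in> A \<Longrightarrow> q \<in> A \<Longrightarrow> \<not> p \<lless> q"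
    and convex: "sw_ne_convex V"
  shows "\<exists>a b :: nat \<Rightarrow> ((position \<Rightarrow>\<^sub>0 int) \<Rightarrow>\<^sub>0 'k::field). \<forall>i j.
    ((i, j) \<notin> V \<longrightarrow> a i * b j = 0) \<and>
    leads (a i * b j) (Poly_Mapping.single (i, j) 1) (if (i, j) \<in> A then 1 else 0)"
proof (cases "A = {}")
  case True
  then show ?thesis by (intro exI[of _ "\<lambda>_. 0"]) (simp add: leads_0)
next
  case False
  have "finite A" using A V by (meson finite_SigmaI finite_atLeastAtMost finite_subset)
  obtain i0 i1 j0 j1 where box: "i0 \<le> i1" "j0 \<le> j1" "A \<subseteq> {i0..i1} \<times> {j0..j1}"
    "{i0..i1} \<times> {j0..j1} \<subseteq> V"
    by (rule antichain_rectangle_subset[OF A \<open>finite A\<close> False antichain convex])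
  \<comment> \<open>A position after all rows of the matrix, so that eps never decides a comparison of blocks.\<close>
  define eps :: "position \<Rightarrow>\<^sub>0 int" where "eps = Poly_Mapping.single (Suc n, 0) 1"
  define e where "e i j = (if (i, j) \<in> A then Poly_Mapping.single (i, j) 1
      else Poly_Mapping.single (i, j) 1 - eps)" for i j
  have super: "e i j' + e i' j \<le> e i j + e i' j'"
    if "i0 \<le> i" "i < i'" "i' \<le> i1" "j0 \<le> j" "j < j'" "j' \<le> j1" for i i' j j'
  proof -
    have "(i', j) \<in> V" using box(4) that by auto
    then have "i' \<le> n" using V by auto
    have "e i j' + e i' j < e i j + e i' j'"
      unfolding less_poly_mapping.rep_eq less_fun_def e_def eps_def
      using that \<open>i' \<le> n\<close>
      by (intro exI[of _ "(i, j)"]) (auto simp: lookup_add lookup_minus lookup_single when_def)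
    then show ?thesis by (rule less_imp_le)
  qed
  obtain \<alpha> \<beta> where
    le: "\<And>i j. i \<in> {i0..i1} \<Longrightarrow> j \<in> {j0..j1} \<Longrightarrow> \<alpha> i + \<beta> j \<le> e i j"
    and eq: "\<And>i j. i \<in> {i0..i1} \<Longrightarrow> j \<in> {j0..j1} \<Longrightarrow> (i, j) \<in> A \<Longrightarrow> \<alpha> i + \<beta> j = e i j"
  proof -
    have "\<exists>\<alpha> \<beta>. (\<forall>i\<in>{i0..i1}. \<forall>j\<in>{j0..j1}. \<alpha> i + \<beta> j \<le> e i j) \<and>
        (\<forall>i\<in>{i0..i1}. \<forall>j\<in>{j0..j1}. (i, j) \<in> A \<longrightarrow> \<alpha> i + \<beta> j = e i j) \<and>
        \<alpha> i0 + \<beta> j1 = e i0 j1"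
      by (rule rank_one_weights[OF box(1,2) super]) (use antichain in blast)+
    then show thesis using that by blast
  qed
  define a where "a i = (if i \<in> {i0..i1} then Poly_Mapping.single (\<alpha> i) (1::'k) else 0)" for i
  define b where "b j = (if j \<in> {j0..j1} then Poly_Mapping.single (\<beta> j) (1::'k) else 0)" for j
  have prod: "a i * b j = (if (i, j) \<in> {i0..i1} \<times> {j0..j1}
      then Poly_Mapping.single (\<alpha> i + \<beta> j) 1 else 0)" for i j
    by (simp add: a_def b_def mult_single)
  have "leads (a i * b j) (Poly_Mapping.single (i, j) 1) (if (i, j) \<in> A then 1 else 0)" for i j
  proof (cases "(i, j) \<in> {i0..i1} \<times> {j0..j1}")
    case True
    then have ij: "i \<in> {i0..i1}" "j \<in> {j0..j1}" by auto
    show ?thesis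
    proof (cases "(i, j) \<in> A")
      case True
      then show ?thesis using eq[OF ij True] ij by (simp add: prod e_def leads_single)
    next
      case False
      have "0 < eps"
        unfolding eps_def less_poly_mapping.rep_eq less_fun_def
        by (intro exI[of _ "(Suc n, 0)"]) (auto simp: lookup_single when_def)
      then have "e i j < Poly_Mapping.single (i, j) 1" using False by (simp add: e_def)
      then have "\<alpha> i + \<beta> j < Poly_Mapping.single (i, j) 1" using le[OF ij] by (rule le_less_trans[rotated])
      then show ?thesis using False ij by (simp add: prod leads_single_less)
    qed
  next
    case False
    then show ?thesis using box(3) by (auto simp: prod leads_0)
  qed
  moreover have "a i * b j = 0" if "(i, j) \<notin> V" for i j
    using that subsetD[OF box(4), of "(i, j)"] by (auto simp: prod)
  ultimately show ?thesis by blast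
qed

text \<open>
  The layers of F are the sets of positions at which the longest chains of F that end there have a
  given length. There are fewer than r of them, and a position of F lies in exactly one, so its
  indeterminate occurs in the sum of the rank-one matrices with coefficient 1.
\<close>
lemma low_rank_matrix:
  assumes V: "V \<subseteq> {1..n} \<times> {1..m}" and F: "F \<subseteq> V" "height F < r"
    and convex: "sw_ne_convex V"
  obtains a b :: "nat \<Rightarrow> nat \<Rightarrow> ((position \<Rightarrow>\<^sub>0 int) \<Rightarrow>\<^sub>0 'k::field)"
  where "\<And>i j. (i, j) \<notin> V \<Longrightarrow> (\<Sum>k<r - 1. a k i * b k j) = 0"
    "\<And>i j. leads (\<Sum>k<r - 1. a k i * b k j) (Poly_Mapping.single (i, j) 1)
        (if (i, j) \<in> F then 1 else 0)"
proof -
  have fF: "finite F" using F(1) V by (meson finite_SigmaI finite_atLeastAtMost finite_subset)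
  define layer where "layer k = {v \<in> F. height {p \<in> F. p \<lless> v} = k}" for k
  have antichain: "\<not> p \<lless> q" if "p \<in> layer k" "q \<in> layer k" for p q k
  proof
    assume "p \<lless> q"
    have "height {x \<in> F. x \<lless> p} + height {p} \<le> height {x \<in> F. x \<lless> q}"
    proof (rule height_add_le)
      show "{p} \<subseteq> {x \<in> F. x \<lless> q}" using that \<open>p \<lless> q\<close> by (auto simp: layer_def)
    qed (use fF \<open>p \<lless> q\<close> in \<open>auto simp: strictly_southeast_def\<close>)
    then show False using that by (simp add: layer_def height_singleton)
  qed
  have "\<exists>a b :: nat \<Rightarrow> ((position \<Rightarrow>\<^sub>0 int) \<Rightarrow>\<^sub>0 'k). \<forall>i j. ((i, j) \<notin> V \<longrightarrow> a i * b j = 0) \<and>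
      leads (a i * b j) (Poly_Mapping.single (i, j) 1) (if (i, j) \<in> layer k then 1 else 0)" for k
    by (rule rank_one_layer[OF V _ antichain convex]) (use F(1) in \<open>auto simp: layer_def\<close>)
  then obtain a b :: "nat \<Rightarrow> nat \<Rightarrow> ((position \<Rightarrow>\<^sub>0 int) \<Rightarrow>\<^sub>0 'k)" where
    zero: "\<And>k i j. (i, j) \<notin> V \<Longrightarrow> a k i * b k j = 0" and
    lead: "\<And>k i j. leads (a k i * b k j) (Poly_Mapping.single (i, j) 1)
        (if (i, j) \<in> layer k then 1 else 0)"
    by metis
  have one: "(\<Sum>k<r - 1. if v \<in> layer k then 1 else (0::'k)) = (if v \<in> F then 1 else 0)" for v
  proof (cases "v \<in> F")
    case True
    have "height {p \<in> F. p \<lless> v} < r - 1" using height_through_le[OF fF True] F(2) by simp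
    then show ?thesis using True by (simp add: layer_def)
  next
    case False
    then show ?thesis by (simp add: layer_def)
  qed
  show thesis
  proof
    show "(\<Sum>k<r - 1. a k i * b k j) = 0" if "(i, j) \<notin> V" for i j
      by (rule sum.neutral) (use zero[OF that] in blast)
    show "leads (\<Sum>k<r - 1. a k i * b k j) (Poly_Mapping.single (i, j) 1)
        (if (i, j) \<in> F then 1 else 0)" for i j
      unfolding one[symmetric] by (rule leads_sum) (rule lead)
  qed
qed

text \<open>
  The matrix factors through r - 1 dimensions. Both factors are padded to size r, which gives the
  second one a zero row.
\<close>
lemma det_sum_of_rank_one_eq_0:
  fixes a b :: "nat \<Rightarrow> nat \<Rightarrow> 'a::comm_ring_1"
  assumes "1 \<le> r"
  shows "det (mat r r (\<lambda>(i, j). \<Sum>k<r - 1. a k i * b k j)) = 0"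
proof -
  define P where "P = mat r r (\<lambda>(i, k). if k < r - 1 then a k i else 0)"
  define Q where "Q = mat r r (\<lambda>(k, j). if k < r - 1 then b k j else 0)"
  have carr: "P \<in> carrier_mat r r" "Q \<in> carrier_mat r r" by (auto simp: P_def Q_def)
  have "mat r r (\<lambda>(i, j). \<Sum>k<r - 1. a k i * b k j) = P * Q"
  proof (rule eq_matI)
    fix i j assume ij: "i < dim_row (P * Q)" "j < dim_col (P * Q)"
    then have ij: "i < r" "j < r" using carr by auto
    have "(P * Q) $$ (i, j) = (\<Sum>k\<in>{0..<r}. P $$ (i, k) * Q $$ (k, j))"
      using ij carr by (auto simp: scalar_prod_def intro!: sum.cong)
    also have "\<dots> = (\<Sum>k\<in>{0..<r}. if k < r - 1 then a k i * b k j else 0)"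
      by (rule sum.cong) (use ij in \<open>auto simp: P_def Q_def\<close>)
    also have "\<dots> = (\<Sum>k<r - 1. a k i * b k j)"
      by (rule sum.mono_neutral_cong_right) auto
    finally show "mat r r (\<lambda>(i, j). \<Sum>k<r - 1. a k i * b k j) $$ (i, j) = (P * Q) $$ (i, j)"
      using ij by simp
  qed (use carr in auto)
  moreover have "det Q = 0"
  proof -
    have "(\<Prod>i = 0..<r. Q $$ (i, p i)) = 0" if p: "p permutes {0..<r}" for p
    proof (rule prod_zero)
      have "p (r - 1) < r" using permutes_in_image[OF p, of "r - 1"] assms by simp
      then show "\<exists>i\<in>{0..<r}. Q $$ (i, p i) = 0"
        using assms by (intro bexI[of _ "r - 1"]) (auto simp: Q_def)
    qed simp
    then show ?thesis unfolding det_def'[OF carr(2)] by (intro sum.neutral) auto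
  qed
  ultimately show ?thesis using det_mult[OF carr] by simp
qed


section \<open>Ideals of the polynomial ring\<close>

lemma poly_ring_simps [simp]:
  "f \<in> carrier (poly_ring V) \<longleftrightarrow> (\<forall>u\<in>Poly_Mapping.keys f. Poly_Mapping.keys u \<subseteq> V)"
  "monoid.mult (poly_ring V) = (*)" "monoid.one (poly_ring V) = 1"
  "ring.zero (poly_ring V) = 0" "ring.add (poly_ring V) = (+)"
  by (simp_all add: poly_ring_def)

lemma poly_ring_add_closed:
  "f \<in> carrier (poly_ring V) \<Longrightarrow> g \<in> carrier (poly_ring V) \<Longrightarrow> f + g \<in> carrier (poly_ring V)"
  using keys_add[of f g] by auto

lemma keys_monom_add:
  "Poly_Mapping.keys (u + w :: monom) = Poly_Mapping.keys u \<union> Poly_Mapping.keys w"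
  by (auto simp: in_keys_iff lookup_add)

lemma poly_ring_mult_closed:
  assumes "f \<in> carrier (poly_ring V)" "g \<in> carrier (poly_ring V)"
  shows "f * g \<in> carrier (poly_ring V)"
proof -
  have "Poly_Mapping.keys u \<subseteq> V" if "u \<in> Poly_Mapping.keys (f * g)" for u
    using that keys_mult[of f g] assms by (fastforce simp: keys_monom_add)
  then show ?thesis by simp
qed

lemma poly_ring_sum_closed:
  "(\<And>x. x \<in> S \<Longrightarrow> f x \<in> carrier (poly_ring V)) \<Longrightarrow> sum f S \<in> carrier (poly_ring V)"
  by (induction S rule: infinite_finite_induct) (auto simp del: poly_ring_simps(1)
      simp: poly_ring_add_closed, auto)

lemma poly_ring_prod_closed:
  "(\<And>x. x \<in> S \<Longrightarrow> f x \<in> carrier (poly_ring V)) \<Longrightarrow> prod f S \<in> carrier (poly_ring V)"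
  by (induction S rule: infinite_finite_induct) (auto simp del: poly_ring_simps(1)
      simp: poly_ring_mult_closed, auto)

lemma ring_poly_ring: "ring (poly_ring V :: 'k::field entry_poly ring)"
proof (rule ringI)
  show "abelian_group (poly_ring V :: 'k entry_poly ring)"
  proof (rule abelian_groupI)
    fix x :: "'k entry_poly" assume "x \<in> carrier (poly_ring V)"
    then show "\<exists>y\<in>carrier (poly_ring V). y \<oplus>\<^bsub>poly_ring V\<^esub> x = \<zero>\<^bsub>poly_ring V\<^esub>"
      by (intro bexI[of _ "- x"]) (auto simp: in_keys_iff)
  qed (use poly_ring_add_closed in \<open>auto simp del: poly_ring_simps(1) simp: ac_simps\<close>, auto)
  show "monoid (poly_ring V :: 'k entry_poly ring)"
    by (rule monoidI)
      (use poly_ring_mult_closed in \<open>auto simp del: poly_ring_simps(1) simp: ac_simps\<close>, auto)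
qed (auto simp: algebra_simps)

lemma ideal_poly_ringI:
  fixes J :: "'k::field entry_poly set"
  assumes "J \<subseteq> carrier (poly_ring V)" "0 \<in> J"
    and "\<And>f g. f \<in> J \<Longrightarrow> g \<in> J \<Longrightarrow> f + g \<in> J"
    and mult: "\<And>f g. f \<in> J \<Longrightarrow> g \<in> carrier (poly_ring V) \<Longrightarrow> g * f \<in> J"
  shows "ideal J (poly_ring V)"
proof (rule idealI)
  have neg: "- f \<in> J" if "f \<in> J" for f
    using mult[OF that, of "- 1"] by simp
  have grp: "group (add_monoid (poly_ring V))"
    by (rule abelian_group.a_group[OF ring.is_abelian_group[OF ring_poly_ring]])
  show "subgroup J (add_monoid (poly_ring V))"
  proof (rule group.subgroupI[OF grp])
    fix f assume f: "f \<in> J"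
    have "inv\<^bsub>add_monoid (poly_ring V)\<^esub> f = - f"
      by (rule group.inv_equality[OF grp])
        (use subsetD[OF assms(1) f] subsetD[OF assms(1) neg[OF f]] in auto)
    then show "inv\<^bsub>add_monoid (poly_ring V)\<^esub> f \<in> J" using neg[OF f] by simp
  qed (use assms in auto)
next
  fix a x :: "'k entry_poly" assume "a \<in> J" "x \<in> carrier (poly_ring V)"
  then show "x \<otimes>\<^bsub>poly_ring V\<^esub> a \<in> J" "a \<otimes>\<^bsub>poly_ring V\<^esub> x \<in> J"
    using mult[of a x] by (simp_all add: mult.commute)
qed (rule ring_poly_ring)

lemma genideal_leI: "ideal J R \<Longrightarrow> S \<subseteq> J \<Longrightarrow> Idl\<^bsub>R\<^esub> S \<subseteq> J"
  by (auto simp: genideal_def)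

lemma indet_prod: "(\<Prod>v\<in>F. indet v) = (power_product (\<Sum>v\<in>F. Poly_Mapping.single v 1) :: 'k::field entry_poly)"
  by (induction F rule: infinite_finite_induct)
    (auto simp: power_product_def indet_def mult_single)

lemma lookup_sum_singles:
  "finite F \<Longrightarrow> Poly_Mapping.lookup (\<Sum>v\<in>F. Poly_Mapping.single v (1::nat)) p = (if p \<in> F then 1 else 0)"
  by (simp add: lookup_sum lookup_single when_def)

lemma keys_sum_singles: "finite F \<Longrightarrow> Poly_Mapping.keys (\<Sum>v\<in>F. Poly_Mapping.single v (1::nat)) = F"
  by (auto simp: in_keys_iff lookup_sum_singles simp del: One_nat_def split: if_splits)

lemma lead_monom_eqI: "leads f d 1 \<Longrightarrow> f \<noteq> 0 \<and> lead_monom f = d"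
  unfolding leads_def lead_monom_def
  by (auto simp: in_keys_iff intro!: Max_eqI)


section \<open>Minors and the initial ideal\<close>

lemma submatrix_card:
  assumes "A \<subseteq> {..<dim_row X}" "B \<subseteq> {..<dim_col X}" "card A = r" "card B = r"
  shows "submatrix X A B = mat r r (\<lambda>(i, j). X $$ (pick A i, pick B j))"
proof -
  have "{i. i < dim_row X \<and> i \<in> A} = A" "{i. i < dim_col X \<and> i \<in> B} = B" using assms by auto
  then show ?thesis using assms by (simp add: submatrix_def)
qed

lemma minor_in_poly_ring:
  assumes V: "V = nonzero_positions n m Z" and f: "f \<in> minors r (generic_matrix n m Z)"
  shows "f \<in> carrier (poly_ring V :: 'k::field entry_poly ring)"
proof -
  define X :: "'k entry_poly mat" where "X = generic_matrix n m Z"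
  obtain A B where AB: "A \<subseteq> {..<n}" "B \<subseteq> {..<m}" "card A = r" "card B = r"
      "f = det (submatrix X A B)"
    using f by (auto simp: minors_def X_def generic_matrix_def)
  define Y where "Y = mat r r (\<lambda>(i, j). X $$ (pick A i, pick B j))"
  have fY: "f = det Y" and Y: "Y \<in> carrier_mat r r"
    using AB submatrix_card[of A X B r] by (auto simp: X_def generic_matrix_def Y_def)
  have entry: "Y $$ (i, j) \<in> carrier (poly_ring V)" if "i < r" "j < r" for i j
  proof -
    have "pick A i \<in> A" "pick B j \<in> B" using pick_in_set_le AB(3,4) that by auto
    then have "pick A i < n" "pick B j < m" using AB(1,2) by auto
    then show ?thesis using that
      by (auto simp: Y_def X_def generic_matrix_def V nonzero_positions_def indet_def power_product_def)
  qed
  have sgn: "signof p \<in> carrier (poly_ring V :: 'k entry_poly ring)" for p :: "nat \<Rightarrow> nat"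
    by (auto simp: sign_def in_keys_iff)
  show ?thesis unfolding fY det_def'[OF Y]
    by (intro poly_ring_sum_closed poly_ring_mult_closed sgn poly_ring_prod_closed entry)
      (auto dest: permutes_in_image)
qed

text \<open>
  The condition that the matrix vanishes outside V makes the substitution compatible with the zero
  entries of the generic matrix.
\<close>
lemma substitute_minor_eq_0:
  fixes a b :: "nat \<Rightarrow> nat \<Rightarrow> ('g::comm_monoid_add \<Rightarrow>\<^sub>0 'k::field)"
  assumes V: "V = nonzero_positions n m Z" and f: "f \<in> minors r (generic_matrix n m Z)"
    and r: "1 \<le> r" and zero: "\<And>i j. (i, j) \<notin> V \<Longrightarrow> (\<Sum>k<r - 1. a k i * b k j) = 0"
  shows "substitute (\<lambda>(i, j). \<Sum>k<r - 1. a k i * b k j) f = 0"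
proof -
  define X :: "'k entry_poly mat" where "X = generic_matrix n m Z"
  define M where "M = (\<lambda>(i, j). \<Sum>k<r - 1. a k i * b k j)"
  obtain A B where AB: "A \<subseteq> {..<n}" "B \<subseteq> {..<m}" "card A = r" "card B = r"
      "f = det (submatrix X A B)"
    using f by (auto simp: minors_def X_def generic_matrix_def)
  define Y where "Y = mat r r (\<lambda>(i, j). X $$ (pick A i, pick B j))"
  have fY: "f = det Y"
    using AB submatrix_card[of A X B r] by (auto simp: X_def generic_matrix_def Y_def)
  have "map_mat (substitute M) Y
      = mat r r (\<lambda>(i, j). \<Sum>k<r - 1. a k (pick A i + 1) * b k (pick B j + 1))"
  proof (rule eq_matI)
    fix i j
    assume "i < dim_row (mat r r (\<lambda>(i, j). \<Sum>k<r - 1. a k (pick A i + 1) * b k (pick B j + 1)))"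
      and "j < dim_col (mat r r (\<lambda>(i, j). \<Sum>k<r - 1. a k (pick A i + 1) * b k (pick B j + 1)))"
    then have ij: "i < r" "j < r" by auto
    then have "pick A i \<in> A" "pick B j \<in> B" using pick_in_set_le AB(3,4) by auto
    then have lt: "pick A i < n" "pick B j < m" using AB(1,2) by auto
    have "substitute M (X $$ (pick A i, pick B j)) = M (pick A i + 1, pick B j + 1)"
    proof (cases "(pick A i + 1, pick B j + 1) \<in> Z")
      case True
      then have "M (pick A i + 1, pick B j + 1) = 0"
        using zero unfolding M_def by (simp add: V nonzero_positions_def)
      then show ?thesis using True lt by (simp add: X_def generic_matrix_def)
    next
      case False
      then show ?thesis using lt by (simp add: X_def generic_matrix_def)
    qed
    then show "map_mat (substitute M) Y $$ (i, j)
        = mat r r (\<lambda>(i, j). \<Sum>k<r - 1. a k (pick A i + 1) * b k (pick B j + 1)) $$ (i, j)"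
      using ij by (simp add: Y_def M_def)
  qed (auto simp: Y_def)
  then have "det (map_mat (substitute M) Y) = 0"
    using det_sum_of_rank_one_eq_0[OF r] by simp
  then show ?thesis by (simp add: fY M_def)
qed

text \<open>
  The bound for the value of a monomial is the monomial itself with integer exponents, so it
  respects the monomial order.
\<close>
lemma weight_mono:
  fixes u w :: monom
  assumes "w < u"
  shows "(\<Sum>v\<in>Poly_Mapping.keys w. Poly_Mapping.single v (int (Poly_Mapping.lookup w v)))
    < (\<Sum>v\<in>Poly_Mapping.keys u. Poly_Mapping.single v (int (Poly_Mapping.lookup u v)))"
proof -
  have look: "Poly_Mapping.lookup (\<Sum>v\<in>Poly_Mapping.keys w.
      Poly_Mapping.single v (int (Poly_Mapping.lookup w v))) p = int (Poly_Mapping.lookup w p)"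
    for w :: monom and p
    by (auto simp: lookup_sum lookup_single when_def in_keys_iff)
  show ?thesis
    using assms unfolding less_poly_mapping.rep_eq less_fun_def look by simp
qed

lemma leads_monom_value:
  fixes M :: "position \<Rightarrow> ((position \<Rightarrow>\<^sub>0 int) \<Rightarrow>\<^sub>0 'k::field)"
  assumes "\<And>v. leads (M v) (Poly_Mapping.single v 1) (c v)"
  shows "leads (monom_value M u)
    (\<Sum>v\<in>Poly_Mapping.keys u. Poly_Mapping.single v (int (Poly_Mapping.lookup u v)))
    (\<Prod>v\<in>Poly_Mapping.keys u. c v ^ Poly_Mapping.lookup u v)"
  unfolding monom_value_def by (intro leads_prod leads_power_single assms)

text \<open>
  The value of the leading monomial attains its bound with coefficient 1, while the values of all
  other monomials of f stay strictly below that bound and cannot cancel it.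
\<close>
lemma substitute_neq_0:
  fixes M :: "position \<Rightarrow> ((position \<Rightarrow>\<^sub>0 int) \<Rightarrow>\<^sub>0 'k::field)"
  assumes f: "f \<noteq> 0" and M: "\<And>v. leads (M v) (Poly_Mapping.single v 1) (c v)"
    and c: "\<And>v. v \<in> Poly_Mapping.keys (lead_monom f) \<Longrightarrow> c v = 1"
  shows "substitute M f \<noteq> 0"
proof
  assume 0: "substitute M f = 0"
  define u where "u = lead_monom f"
  define wt :: "monom \<Rightarrow> (position \<Rightarrow>\<^sub>0 int)" where
    "wt w = (\<Sum>v\<in>Poly_Mapping.keys w. Poly_Mapping.single v (int (Poly_Mapping.lookup w v)))" for w
  define a where "a w = (if w = u then Poly_Mapping.lookup f u else 0)" for w
  have u: "u \<in> Poly_Mapping.keys f" unfolding u_def lead_monom_def using f by (intro Max_in) auto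
  have "leads (Poly_Mapping.single 0 (Poly_Mapping.lookup f w) * monom_value M w) (wt u) (a w)"
    if w: "w \<in> Poly_Mapping.keys f" for w
  proof -
    have l: "leads (Poly_Mapping.single 0 (Poly_Mapping.lookup f w) * monom_value M w) (0 + wt w)
        (Poly_Mapping.lookup f w * (\<Prod>v\<in>Poly_Mapping.keys w. c v ^ Poly_Mapping.lookup w v))"
      unfolding wt_def by (intro leads_mult leads_single leads_monom_value M)
    show ?thesis
    proof (cases "w = u")
      case True
      have "(\<Prod>v\<in>Poly_Mapping.keys u. c v ^ Poly_Mapping.lookup u v) = 1"
        by (rule prod.neutral) (simp add: c u_def)
      then show ?thesis using l True by (simp add: a_def)
    next
      case False
      have "w \<le> u" unfolding u_def lead_monom_def using w by (intro Max_ge) auto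
      then have "wt w < wt u" using False weight_mono[of w u] by (simp add: wt_def)
      then show ?thesis using leads_less[OF l, of "wt u"] False by (simp add: a_def)
    qed
  qed
  then have "leads (substitute M f) (wt u) (\<Sum>w\<in>Poly_Mapping.keys f. a w)"
    unfolding substitute_def by (rule leads_sum)
  then have "(\<Sum>w\<in>Poly_Mapping.keys f. a w) = 0" unfolding 0 by (simp add: leads_def)
  moreover have "(\<Sum>w\<in>Poly_Mapping.keys f. a w) = Poly_Mapping.lookup f u"
    using u by (simp add: a_def)
  ultimately show False using u by (simp add: in_keys_iff)
qed

text \<open>
  Polynomials that vanish on a given matrix of rank less than r with the prescribed zeros form an
  ideal that contains the minors. If the support of the leading monomial of f had no chain of r
  positions, \<open>low_rank_matrix\<close> would supply such a matrix on which f does not vanish.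
\<close>
lemma lead_monom_contains_chain:
  fixes f :: "'k::field entry_poly"
  assumes V: "V = nonzero_positions n m Z" and r: "1 \<le> r"
    and convex: "sw_ne_convex V"
    and f: "f \<in> minor_ideal V r (generic_matrix n m Z)" "f \<noteq> 0"
  shows "f \<in> carrier (poly_ring V)" and "r \<le> height (Poly_Mapping.keys (lead_monom f))"
proof -
  have VG: "V \<subseteq> {1..n} \<times> {1..m}" by (auto simp: V nonzero_positions_def)
  have main: "f \<in> carrier (poly_ring V) \<and> substitute (\<lambda>(i, j). \<Sum>k<r - 1. a k i * b k j) f = 0"
    if zero: "\<And>i j. (i, j) \<notin> V \<Longrightarrow> (\<Sum>k<r - 1. a k i * b k j) = 0"
    for a b :: "nat \<Rightarrow> nat \<Rightarrow> ((position \<Rightarrow>\<^sub>0 int) \<Rightarrow>\<^sub>0 'k)"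
  proof -
    let ?M = "\<lambda>(i, j). \<Sum>k<r - 1. a k i * b k j"
    let ?J = "{f \<in> carrier (poly_ring V). substitute ?M f = 0}"
    have "ideal ?J (poly_ring V)"
    proof (rule ideal_poly_ringI)
      fix f g assume "f \<in> ?J" "g \<in> ?J"
      then show "f + g \<in> ?J"
        by (auto simp del: poly_ring_simps(1) simp: poly_ring_add_closed substitute_add)
    next
      fix f g :: "'k entry_poly" assume "f \<in> ?J" "g \<in> carrier (poly_ring V)"
      then show "g * f \<in> ?J"
        by (auto simp del: poly_ring_simps(1) simp: poly_ring_mult_closed substitute_mult)
    qed auto
    moreover have "minors r (generic_matrix n m Z) \<subseteq> ?J"
    proof
      fix g assume g: "g \<in> minors r (generic_matrix n m Z :: 'k entry_poly mat)"
      then have "substitute ?M g = 0" by (rule substitute_minor_eq_0[OF V _ r zero])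
      then show "g \<in> ?J" using minor_in_poly_ring[OF V g] by blast
    qed
    ultimately have "minor_ideal V r (generic_matrix n m Z) \<subseteq> ?J"
      unfolding minor_ideal_def by (rule genideal_leI)
    then show ?thesis using f(1) by blast
  qed
  show car: "f \<in> carrier (poly_ring V)" using main[of "\<lambda>_ _. 0" "\<lambda>_ _. 0"] by simp
  show "r \<le> height (Poly_Mapping.keys (lead_monom f))"
  proof (rule ccontr)
    assume "\<not> r \<le> height (Poly_Mapping.keys (lead_monom f))"
    then have less: "height (Poly_Mapping.keys (lead_monom f)) < r" by simp
    have "lead_monom f \<in> Poly_Mapping.keys f"
      unfolding lead_monom_def using f(2) by (intro Max_in) auto
    then have sub: "Poly_Mapping.keys (lead_monom f) \<subseteq> V" using car by auto
    obtain a b :: "nat \<Rightarrow> nat \<Rightarrow> ((position \<Rightarrow>\<^sub>0 int) \<Rightarrow>\<^sub>0 'k)" where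
      zero: "\<And>i j. (i, j) \<notin> V \<Longrightarrow> (\<Sum>k<r - 1. a k i * b k j) = 0" and
      lead: "\<And>i j. leads (\<Sum>k<r - 1. a k i * b k j) (Poly_Mapping.single (i, j) 1)
          (if (i, j) \<in> Poly_Mapping.keys (lead_monom f) then 1 else 0)"
    proof (rule low_rank_matrix[OF VG sub less convex, where ?'k = 'k])
      fix a b :: "nat \<Rightarrow> nat \<Rightarrow> ((position \<Rightarrow>\<^sub>0 int) \<Rightarrow>\<^sub>0 'k)"
      assume "\<And>i j. (i, j) \<notin> V \<Longrightarrow> (\<Sum>k<r - 1. a k i * b k j) = 0"
        and "\<And>i j. leads (\<Sum>k<r - 1. a k i * b k j) (Poly_Mapping.single (i, j) 1)
            (if (i, j) \<in> Poly_Mapping.keys (lead_monom f) then 1 else 0)"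
      then show thesis by (rule that)
    qed
    have "leads ((\<lambda>(i, j). \<Sum>k<r - 1. a k i * b k j) v) (Poly_Mapping.single v 1)
        (if v \<in> Poly_Mapping.keys (lead_monom f) then 1 else 0)" for v
      using lead[of "fst v" "snd v"] by (simp add: case_prod_beta)
    then have "substitute (\<lambda>(i, j). \<Sum>k<r - 1. a k i * b k j) f \<noteq> 0"
      by (rule substitute_neq_0[OF f(2)]) simp
    then show False using main[OF zero] by simp
  qed
qed

lemma pick_sorted:
  assumes "sorted_wrt (<) ys" "k < length ys"
  shows "pick (set ys) k = ys ! k"
proof -
  have "{a \<in> set ys. a < ys ! k} = (!) ys ` {..<k}"
  proof (intro equalityI subsetI)
    fix a assume "a \<in> {a \<in> set ys. a < ys ! k}"
    then obtain l where l: "l < length ys" "a = ys ! l" "ys ! l < ys ! k" by (auto simp: in_set_conv_nth)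
    then have "l < k" using assms sorted_wrt_nth_less[OF assms(1), of k l] by (cases "l < k") (auto simp: not_less le_less)
    then show "a \<in> (!) ys ` {..<k}" using l by auto
  qed (use assms sorted_wrt_nth_less[OF assms(1), of _ k] in auto)
  moreover have "inj_on ((!) ys) {..<k}"
    using assms strict_sorted_iff[of ys] by (intro inj_on_nth) auto
  ultimately have "card {a \<in> set ys. a < ys ! k} = k" by (simp add: card_image)
  then show ?thesis using pick_card_in_set[of "ys ! k" "set ys"] assms(2) by simp
qed

text \<open>
  At the first index k moved by p, the diagonal contains the position \<open>xs ! k\<close>, which the permuted
  term lacks; all positions before it occur equally often in both, because the permuted term
  uses a later column in that row.
\<close>
lemma permuted_diagonal_less:
  fixes p :: "nat \<Rightarrow> nat"
  assumes xs: "sorted_wrt (\<lless>) xs" "length xs = r" and p: "p permutes {0..<r}" "p \<noteq> id"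
  shows "(\<Sum>i = 0..<r. Poly_Mapping.single (fst (xs ! i), snd (xs ! p i)) (1::nat))
    < (\<Sum>i = 0..<r. Poly_Mapping.single (fst (xs ! i), snd (xs ! i)) 1)"
proof -
  have less: "xs ! i \<lless> xs ! j" if "i < j" "j < r" for i j
    using sorted_wrt_nth_less[OF xs(1) that(1)] that xs(2) by simp
  have mono: "fst (xs ! i) < fst (xs ! j) \<longleftrightarrow> i < j" "snd (xs ! i) < snd (xs ! j) \<longleftrightarrow> i < j"
    if "i < r" "j < r" for i j
    using less[of i j] less[of j i] that
    by (auto simp: strictly_southeast_def) (metis linorder_neqE_nat less_asym less_irrefl)+
  have eq: "fst (xs ! i) = fst (xs ! j) \<longleftrightarrow> i = j" "snd (xs ! i) = snd (xs ! j) \<longleftrightarrow> i = j"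
    if "i < r" "j < r" for i j
    using mono[of i j] mono[of j i] that by (metis less_irrefl linorder_neqE_nat)+
  define k where "k = (LEAST k. p k \<noteq> k)"
  have "\<exists>k. p k \<noteq> k" using p(2) by (auto simp: fun_eq_iff)
  then have k: "p k \<noteq> k" unfolding k_def by (rule LeastI_ex)
  have before: "p l = l" if "l < k" for l using not_less_Least that unfolding k_def by blast
  have kr: "k < r" using k p(1) by (metis atLeastLessThan_iff permutes_not_in zero_le)
  have pr: "p i < r" if "i < r" for i using permutes_in_image[OF p(1), of i] that by simp
  have pk: "k < p k"
  proof (rule ccontr)
    assume "\<not> k < p k"
    then have "p k < k" using k by simp
    then have "p (p k) = p k" by (rule before)
    then show False using k permutes_inj[OF p(1)] by (auto dest: injD)
  qed
  have look: "Poly_Mapping.lookup (\<Sum>i = 0..<r. Poly_Mapping.single (fst (xs ! i), snd (xs ! g i)) (1::nat)) q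
      = (\<Sum>i = 0..<r. if (fst (xs ! i), snd (xs ! g i)) = q then 1 else 0)" for g q
    by (simp add: lookup_sum lookup_single when_def del: One_nat_def)
  show ?thesis
    unfolding monom_less_iff look[of p] look[of "\<lambda>i. i"]
  proof (rule exI[of _ "xs ! k"], intro conjI allI impI)
    have "(\<Sum>i = 0..<r. if (fst (xs ! i), snd (xs ! p i)) = xs ! k then 1 else (0::nat)) = 0"
    proof (rule sum.neutral, rule ballI)
      fix i assume "i \<in> {0..<r}"
      then have "i < r" by simp
      then have "(fst (xs ! i), snd (xs ! p i)) \<noteq> xs ! k"
        using eq(1)[of i k] eq(2)[of "p i" k] pr kr k by (cases "xs ! k") auto
      then show "(if (fst (xs ! i), snd (xs ! p i)) = xs ! k then 1 else (0::nat)) = 0" by simp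
    qed
    moreover have "(if (fst (xs ! k), snd (xs ! k)) = xs ! k then 1 else (0::nat))
        \<le> (\<Sum>i = 0..<r. if (fst (xs ! i), snd (xs ! i)) = xs ! k then 1 else 0)"
      by (rule member_le_sum) (use kr in auto)
    then have "1 \<le> (\<Sum>i = 0..<r. if (fst (xs ! i), snd (xs ! i)) = xs ! k then 1 else (0::nat))"
      by simp
    ultimately show "(\<Sum>i = 0..<r. if (fst (xs ! i), snd (xs ! p i)) = xs ! k then 1 else (0::nat))
        < (\<Sum>i = 0..<r. if (fst (xs ! i), snd (xs ! i)) = xs ! k then 1 else 0)" by linarith
  next
    fix q assume "q < xs ! k"
    then have q': "fst q < fst (xs ! k) \<or> fst q = fst (xs ! k) \<and> snd q < snd (xs ! k)"
      by (cases q; cases "xs ! k") auto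
    show "(\<Sum>i = 0..<r. if (fst (xs ! i), snd (xs ! p i)) = q then 1 else (0::nat))
        = (\<Sum>i = 0..<r. if (fst (xs ! i), snd (xs ! i)) = q then 1 else 0)"
    proof (rule sum.cong[OF refl])
      fix i assume "i \<in> {0..<r}"
      then have i: "i < r" by simp
      have "(fst (xs ! i), snd (xs ! p i)) \<noteq> q \<and> (fst (xs ! i), snd (xs ! i)) \<noteq> q" if "k \<le> i"
      proof (cases "k = i")
        case True
        then have "snd (xs ! k) < snd (xs ! p i)" using mono(2)[of k "p i"] i pk pr[OF i] by simp
        then show ?thesis using q' True by auto
      next
        case False
        then have "fst (xs ! k) < fst (xs ! i)" using mono(1)[of k i] i kr that by simp
        then show ?thesis using q' by auto
      qed
      then show "(if (fst (xs ! i), snd (xs ! p i)) = q then 1 else (0::nat))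
          = (if (fst (xs ! i), snd (xs ! i)) = q then 1 else 0)"
        using before[of i] by (cases "i < k") auto
    qed
  qed
qed

text \<open>
  The minor with the rows and columns of the chain: its diagonal has no zero entry, and the other
  terms of the determinant vanish or are smaller.
\<close>
lemma chain_is_lead_monom:
  assumes V: "V = nonzero_positions n m Z" and xs: "xs \<in> strict_chains V" "length xs = r"
  obtains f :: "'k::field entry_poly"
  where "f \<in> minors r (generic_matrix n m Z)" "f \<noteq> 0"
    "lead_monom f = (\<Sum>v\<in>set xs. Poly_Mapping.single v 1)"
proof -
  define X :: "'k entry_poly mat" where "X = generic_matrix n m Z"
  define A where "A = set (map (\<lambda>v. fst v - 1) xs)"
  define B where "B = set (map (\<lambda>v. snd v - 1) xs)"
  have chain: "sorted_wrt (\<lless>) xs" and xsV: "set xs \<subseteq> V" using xs by (auto simp: strict_chains_def)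
  have pos: "1 \<le> fst v \<and> fst v \<le> n \<and> 1 \<le> snd v \<and> snd v \<le> m \<and> v \<notin> Z" if "v \<in> set xs" for v
    using that xsV by (auto simp: V nonzero_positions_def)
  have sA: "sorted_wrt (<) (map (\<lambda>v. fst v - 1) xs)" and sB: "sorted_wrt (<) (map (\<lambda>v. snd v - 1) xs)"
    unfolding sorted_wrt_map
    by (rule sorted_wrt_mono_rel[OF _ chain], use pos in \<open>force simp: strictly_southeast_def\<close>)+
  have pick: "pick A i = fst (xs ! i) - 1" "pick B i = snd (xs ! i) - 1" if "i < r" for i
    using pick_sorted[OF sA, of i] pick_sorted[OF sB, of i] that xs(2) by (simp_all add: A_def B_def)
  have card: "card A = r" "card B = r"
    unfolding A_def B_def using sA sB xs(2) strict_sorted_iff distinct_card length_map by metis+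
  have sub: "A \<subseteq> {..<n}" "B \<subseteq> {..<m}" using pos by (fastforce simp: A_def B_def)+
  define Y where "Y = mat r r (\<lambda>(i, j). X $$ (pick A i, pick B j))"
  have Y: "Y \<in> carrier_mat r r" by (simp add: Y_def)
  have YAB: "det (submatrix X A B) = det Y"
    using submatrix_card[of A X B r] sub card by (simp add: X_def generic_matrix_def Y_def)
  have entry: "Y $$ (i, j) = (if (fst (xs ! i), snd (xs ! j)) \<in> Z then 0
      else Poly_Mapping.single (Poly_Mapping.single (fst (xs ! i), snd (xs ! j)) 1) 1)"
    if "i < r" "j < r" for i j
    using that pos[of "xs ! i"] pos[of "xs ! j"] xs(2)
    by (auto simp: Y_def X_def generic_matrix_def pick indet_def power_product_def)
  define diag :: monom where
    "diag = (\<Sum>i = 0..<r. Poly_Mapping.single (fst (xs ! i), snd (xs ! i)) 1)"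
  have leads_term: "leads (signof p * (\<Prod>i = 0..<r. Y $$ (i, p i))) diag (if p = id then 1 else 0)"
    if p: "p permutes {0..<r}" for p
  proof -
    define c where "c i = (if (fst (xs ! i), snd (xs ! p i)) \<in> Z then 0 else (1::'k))" for i
    have prod: "leads (\<Prod>i = 0..<r. Y $$ (i, p i))
        (\<Sum>i = 0..<r. Poly_Mapping.single (fst (xs ! i), snd (xs ! p i)) 1) (\<Prod>i = 0..<r. c i)"
    proof (rule leads_prod)
      fix i assume "i \<in> {0..<r}"
      then have "i < r" "p i < r" using permutes_in_image[OF p, of i] by auto
      then show "leads (Y $$ (i, p i)) (Poly_Mapping.single (fst (xs ! i), snd (xs ! p i)) 1) (c i)"
        by (simp add: entry c_def leads_0 leads_single)
    qed
    show ?thesis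
    proof (cases "p = id")
      case True
      have "(\<Prod>i = 0..<r. c i) = 1"
        using pos xs(2) True by (intro prod.neutral) (simp add: c_def)
      then show ?thesis using prod True by (simp add: diag_def)
    next
      case False
      have "leads (\<Prod>i = 0..<r. Y $$ (i, p i)) diag 0"
        using leads_less[OF prod] permuted_diagonal_less[OF chain xs(2) p False] by (simp add: diag_def)
      then have "leads (signof p * (\<Prod>i = 0..<r. Y $$ (i, p i))) diag 0"
        by (cases "sign p = 1") (auto simp: sign_def leads_def in_keys_iff split: if_splits)
      then show ?thesis using False by simp
    qed
  qed
  have "leads (det Y) diag (\<Sum>p\<in>{p. p permutes {0..<r}}. if p = id then 1 else 0)"
    unfolding det_def'[OF Y] by (rule leads_sum) (use leads_term in auto)
  moreover have "(\<Sum>p\<in>{p. p permutes {0..<r}}. if p = id then 1 else (0::'k)) = 1"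
    by (simp add: finite_permutations permutes_id)
  ultimately have lead: "leads (det Y) diag 1" by simp
  have "diag = (\<Sum>v\<in>set xs. Poly_Mapping.single v 1)"
    using sum.reindex_bij_betw[OF bij_betw_nth[OF distinct_chain[OF chain] refl refl],
        of "\<lambda>v. Poly_Mapping.single v (1::nat)"] xs(2)
    by (simp add: diag_def atLeast0LessThan)
  moreover have "det Y \<in> minors r X"
    unfolding minors_def YAB[symmetric] using sub card by (auto simp: X_def generic_matrix_def)
  ultimately show thesis using that lead_monom_eqI[OF lead] by (auto simp: X_def)
qed

text \<open>
  Polynomials all of whose monomials have a support with a chain of r positions form an ideal that
  contains the initial ideal. Conversely, a set with such a chain yields a multiple of the leading
  monomial of a minor.
\<close>
lemma initial_complex_eq_chain_complex:
  assumes V: "V = nonzero_positions n m Z" and r: "1 \<le> r"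
    and convex: "sw_ne_convex V"
  shows "initial_complex V (minor_ideal V r (generic_matrix n m Z :: 'k::field entry_poly mat))
    = chain_complex r V {}"
proof -
  define X :: "'k entry_poly mat" where "X = generic_matrix n m Z"
  define I where "I = minor_ideal V r X"
  have fV: "finite V" by (simp add: V nonzero_positions_def)
  have "(\<Prod>v\<in>F. indet v) \<in> initial_ideal V I \<longleftrightarrow> r \<le> height F" if F: "F \<subseteq> V" for F
  proof
    have fF: "finite F" using F fV by (rule finite_subset)
    define J where "J = {f \<in> carrier (poly_ring V :: 'k entry_poly ring).
        \<forall>u\<in>Poly_Mapping.keys f. r \<le> height (Poly_Mapping.keys u)}"
    have "ideal J (poly_ring V)"
    proof (rule ideal_poly_ringI)
      fix f g assume fg: "f \<in> J" "g \<in> J"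
      then have "f + g \<in> carrier (poly_ring V)"
        by (intro poly_ring_add_closed) (auto simp: J_def)
      then show "f + g \<in> J" using fg keys_add[of f g] unfolding J_def by blast
    next
      fix f g :: "'k entry_poly" assume fg: "f \<in> J" "g \<in> carrier (poly_ring V)"
      have "r \<le> height (Poly_Mapping.keys w)" if w': "w \<in> Poly_Mapping.keys (g * f)" for w
      proof -
        obtain x y where w: "w = x + y" "y \<in> Poly_Mapping.keys f"
          using w' keys_mult[of g f] by blast
        have "height (Poly_Mapping.keys y) \<le> height (Poly_Mapping.keys w)"
          by (rule height_mono) (auto simp: w(1) keys_monom_add)
        moreover have "r \<le> height (Poly_Mapping.keys y)" using fg(1) w(2) by (simp add: J_def)
        ultimately show ?thesis by simp
      qed
      moreover have "g * f \<in> carrier (poly_ring V)"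
        using fg by (intro poly_ring_mult_closed) (auto simp: J_def)
      ultimately show "g * f \<in> J" by (simp add: J_def)
    qed (auto simp: J_def)
    moreover have "power_product (lead_monom f) \<in> J" if f: "f \<in> I" "f \<noteq> 0" for f
    proof -
      note lead = lead_monom_contains_chain[OF V r convex, of f]
      have "lead_monom f \<in> Poly_Mapping.keys f"
        unfolding lead_monom_def using f(2) by (intro Max_in) auto
      moreover have "f \<in> carrier (poly_ring V)" "r \<le> height (Poly_Mapping.keys (lead_monom f))"
        using f by (auto intro!: lead simp: I_def X_def simp del: poly_ring_simps(1))
      ultimately show ?thesis by (simp add: J_def power_product_def)
    qed
    ultimately have sub: "initial_ideal V I \<subseteq> J"
      unfolding initial_ideal_def by (intro genideal_leI) auto
    assume "(\<Prod>v\<in>F. indet v) \<in> initial_ideal V I"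
    then have "power_product (\<Sum>v\<in>F. Poly_Mapping.single v 1) \<in> J"
      using sub unfolding indet_prod by blast
    then show "r \<le> height F" 
      by (simp add: J_def power_product_def keys_sum_singles[OF fF] del: One_nat_def)
  next
    have fF: "finite F" using F fV by (rule finite_subset)
    assume "r \<le> height F"
    obtain ys where ys: "ys \<in> strict_chains F" "length ys = height F"
      by (rule height_attained[OF fF])
    define xs where "xs = take r ys"
    have xsF: "set xs \<subseteq> F" and len: "length xs = r"
      using ys \<open>r \<le> height F\<close> set_take_subset[of r ys] by (auto simp: xs_def strict_chains_def)
    have xs: "xs \<in> strict_chains V"
      using ys xsF F by (auto simp: xs_def strict_chains_def sorted_wrt_take)
    obtain f :: "'k entry_poly" where f: "f \<in> minors r X" "f \<noteq> 0"
      "lead_monom f = (\<Sum>v\<in>set xs. Poly_Mapping.single v 1)"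
      unfolding X_def by (rule chain_is_lead_monom[OF V xs len])
    have fI: "f \<in> I" using f(1) by (auto simp: I_def minor_ideal_def genideal_def)
    define w :: monom where "w = (\<Sum>v\<in>F - set xs. Poly_Mapping.single v 1)"
    have w: "power_product w \<in> carrier (poly_ring V :: 'k entry_poly ring)"
      using F fF by (auto simp: power_product_def w_def keys_sum_singles simp del: One_nat_def)
    have split: "(\<Prod>v\<in>F. indet v) = (power_product w * power_product (lead_monom f) :: 'k entry_poly)"
      unfolding indet_prod w_def f(3) power_product_def
      using sum.subset_diff[OF xsF fF, of "\<lambda>v. Poly_Mapping.single v (1::nat)"]
      by (simp add: mult_single)
    show "(\<Prod>v\<in>F. indet v) \<in> initial_ideal V I"
      unfolding initial_ideal_def genideal_def
    proof (rule InterI)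
      fix J :: "'k entry_poly set"
      assume "J \<in> {J. ideal J (poly_ring V) \<and> {power_product (lead_monom f) |f. f \<in> I \<and> f \<noteq> 0} \<subseteq> J}"
      then have J: "ideal J (poly_ring V)" "power_product (lead_monom f) \<in> J" using fI f(2) by auto
      show "(\<Prod>v\<in>F. indet v) \<in> J" unfolding split using ideal.I_l_closed[OF J(1,2) w] by simp
    qed
  qed
  then show ?thesis by (auto simp: initial_complex_def chain_complex_def I_def X_def not_le)
qed


section \<open>Matrices with triangular or small ladders\<close>

lemma sw_ne_convex_nonzero_positions:
  assumes gd: "gd_data n m s c t d"
    and V: "V = nonzero_positions n m (lower_ladder n s c \<union> upper_ladder m t d)"
  shows "sw_ne_convex V"
  unfolding sw_ne_convex_def
proof (intro allI impI subsetI)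
  fix i i' j j' v
  assume sw: "(i', j) \<in> V" and ne: "(i, j') \<in> V" and "v \<in> {i..i'} \<times> {j..j'}"
  then obtain a b where v: "v = (a, b)" and le: "i \<le> a" "a \<le> i'" "j \<le> b" "b \<le> j'" by auto
  have grid: "1 \<le> i" "i' \<le> n" "1 \<le> j" "j' \<le> m"
    using sw ne by (auto simp: V nonzero_positions_def)
  have "(a, b) \<notin> lower_ladder n s c"
  proof
    assume "(a, b) \<in> lower_ladder n s c"
    then have ab: "b \<in> {1..s}" "n - c b < a" by (auto simp: lower_ladder_def)
    have "antimono_on {1..s} c" using gd by (simp add: gd_data_def)
    then have "c b \<le> c j" using ab(1) grid(3) le(3) by (auto simp: monotone_on_def)
    then have "(i', j) \<in> lower_ladder n s c" using ab le grid by (auto simp: lower_ladder_def)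
    then show False using sw by (simp add: V nonzero_positions_def)
  qed
  moreover have "(a, b) \<notin> upper_ladder m t d"
  proof
    assume "(a, b) \<in> upper_ladder m t d"
    then have ab: "b \<in> {t..m}" "a \<le> d b" by (auto simp: upper_ladder_def)
    have "mono_on {t..m} d" using gd by (simp add: gd_data_def)
    then have "d b \<le> d j'" using ab(1) grid(4) le(4) by (auto simp: monotone_on_def)
    then have "(i, j') \<in> upper_ladder m t d" using ab le grid by (auto simp: upper_ladder_def)
    then show False using ne by (simp add: V nonzero_positions_def)
  qed
  ultimately show "v \<in> V" using grid le by (simp add: V v nonzero_positions_def)
qed

lemma lower_triangle_iff:
  assumes gd: "gd_data n m s c t d" and tri: "lower_triangle s c t1"
  shows "(i, j) \<in> lower_ladder n s c \<longleftrightarrow> 1 \<le> j \<and> i \<le> n \<and> int n - int t1 \<le> int i - int j"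
proof (cases "1 \<le> j \<and> j \<le> t1")
  case True
  have s: "s = t1" and c: "\<And>i. 1 \<le> i \<Longrightarrow> i \<le> t1 \<Longrightarrow> c i = t1 + 1 - i"
    using tri by (auto simp: lower_triangle_def)
  have "c 1 < n" using gd True s by (auto simp: gd_data_def)
  then have "t1 < n" using c[of 1] True by simp
  then show ?thesis using True c[of j] by (auto simp: lower_ladder_def s)
next
  case False
  then show ?thesis using tri by (auto simp: lower_ladder_def lower_triangle_def)
qed

lemma upper_triangle_iff:
  assumes gd: "gd_data n m s c t d" and tri: "upper_triangle m t d t2"
  shows "(i, j) \<in> upper_ladder m t d \<longleftrightarrow> 1 \<le> i \<and> j \<le> m \<and> int m - int t2 \<le> int j - int i"
proof (cases "t \<le> j \<and> j \<le> m")
  case True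
  have t: "t + t2 = m + 1" and d: "\<And>i. 1 \<le> i \<Longrightarrow> i \<le> t2 \<Longrightarrow> d (m - t2 + i) = i"
    using tri by (auto simp: upper_triangle_def)
  have t1: "1 < t" using gd by (simp add: gd_data_def)
  have "m - t2 + (j - (m - t2)) = j" "1 \<le> j - (m - t2)" "j - (m - t2) \<le> t2"
    using True t t1 by auto
  then have "d j = j - (m - t2)" using d[of "j - (m - t2)"] by simp
  then show ?thesis using True t t1 by (auto simp: upper_ladder_def)
next
  case False
  then show ?thesis using tri gd by (auto simp: upper_ladder_def upper_triangle_def gd_data_def)
qed

text \<open>
  Near the lower left corner a chain through v has few columns before v and few rows after v.
\<close>
lemma short_chains_lower_corner:
  assumes V: "V \<subseteq> {1..n} \<times> {1..m}" and v: "v \<in> V"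
    and corner: "int n - (int r - 1) \<le> int (fst v) - int (snd v)"
  shows "height {p \<in> V. p \<lless> v} + 1 + height {p \<in> V. v \<lless> p} < r"
proof -
  have fV: "finite V" using V by (rule finite_subset) simp
  have "height {p \<in> V. p \<lless> v} \<le> card {1..<snd v}"
    by (rule height_le_card_columns) (use fV V in \<open>auto simp: strictly_southeast_def\<close>)
  moreover have "height {p \<in> V. v \<lless> p} \<le> card {fst v<..n}"
    by (rule height_le_card_rows) (use fV V in \<open>auto simp: strictly_southeast_def\<close>)
  moreover have "1 \<le> fst v" "fst v \<le> n" "1 \<le> snd v" using v V by auto
  ultimately show ?thesis using corner by auto
qed

lemma short_chains_upper_corner:
  assumes V: "V \<subseteq> {1..n} \<times> {1..m}" and v: "v \<in> V"
    and corner: "int m - (int r - 1) \<le> int (snd v) - int (fst v)"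
  shows "height {p \<in> V. p \<lless> v} + 1 + height {p \<in> V. v \<lless> p} < r"
proof -
  have fV: "finite V" using V by (rule finite_subset) simp
  have "height {p \<in> V. p \<lless> v} \<le> card {1..<fst v}"
    by (rule height_le_card_rows) (use fV V in \<open>auto simp: strictly_southeast_def\<close>)
  moreover have "height {p \<in> V. v \<lless> p} \<le> card {snd v<..m}"
    by (rule height_le_card_columns) (use fV V in \<open>auto simp: strictly_southeast_def\<close>)
  moreover have "1 \<le> fst v" "snd v \<le> m" "1 \<le> snd v" using v V by auto
  ultimately show ?thesis using corner by auto
qed

theorem theorem5p7:
  fixes n m s t r :: nat
    and c d :: "nat \<Rightarrow> nat"
    and L1 L2 V :: "position set"
    and X :: "'k::field entry_poly mat"
    and I :: "'k entry_poly set"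
  assumes "gd_data n m s c t d"
    and "L1 = lower_ladder n s c"
    and "L2 = upper_ladder m t d"
    and "V = nonzero_positions n m (L1 \<union> L2)"
    and "X = generic_matrix n m (L1 \<union> L2)"
    and "r \<ge> 1"
    and "I = minor_ideal V r X"
    and "(\<exists>t1. lower_triangle s c t1) \<or> lower_in_triangle n r L1"
    and "(\<exists>t2. upper_triangle m t d t2) \<or> upper_in_triangle m r L2"
  shows "vertex_decomposable (initial_complex V I)"
proof -
  have VG: "V \<subseteq> {1..n} \<times> {1..m}" by (auto simp: assms(4) nonzero_positions_def)
  have diag: "height {p \<in> V. p \<lless> v} + 1 + height {p \<in> V. v \<lless> p} < r"
    if v: "v \<in> V" and w: "w \<in> {1..n} \<times> {1..m} - V"
      and vw: "int (snd v) - int (fst v) = int (snd w) - int (fst w)" for v w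
  proof -
    obtain i j where v_eq: "v = (i, j)" by (cases v)
    obtain i' j' where w_eq: "w = (i', j')" by (cases w)
    have ij: "1 \<le> i" "i \<le> n" "1 \<le> j" "j \<le> m" "(i, j) \<notin> L1" "(i, j) \<notin> L2"
      using v v_eq by (auto simp: assms(4) nonzero_positions_def)
    have "w \<in> L1 \<or> w \<in> L2" using w by (auto simp: assms(4) nonzero_positions_def)
    then show ?thesis
    proof
      assume "w \<in> L1"
      from assms(8) show ?thesis
      proof
        assume "\<exists>t1. lower_triangle s c t1"
        then obtain t1 where t1: "lower_triangle s c t1" by blast
        have "(i, j) \<in> L1"
          using \<open>w \<in> L1\<close> vw ij unfolding assms(2) w_eq v_eq lower_triangle_iff[OF assms(1) t1] by simp
        then show ?thesis using ij by simp
      next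
        assume "lower_in_triangle n r L1"
        then have "int n - (int r - 1) \<le> int i' - int j'"
          using \<open>w \<in> L1\<close> by (auto simp: lower_in_triangle_def w_eq)
        then show ?thesis
          by (intro short_chains_lower_corner[OF VG v]) (use vw v_eq w_eq in simp)
      qed
    next
      assume "w \<in> L2"
      from assms(9) show ?thesis
      proof
        assume "\<exists>t2. upper_triangle m t d t2"
        then obtain t2 where t2: "upper_triangle m t d t2" by blast
        have "(i, j) \<in> L2"
          using \<open>w \<in> L2\<close> vw ij unfolding assms(3) w_eq v_eq upper_triangle_iff[OF assms(1) t2] by simp
        then show ?thesis using ij by simp
      next
        assume "upper_in_triangle m r L2"
        then have "int m - (int r - 1) \<le> int j' - int i'"
          using \<open>w \<in> L2\<close> by (auto simp: upper_in_triangle_def w_eq)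
        then show ?thesis
          by (intro short_chains_upper_corner[OF VG v]) (use vw v_eq w_eq in simp)
      qed
    qed
  qed
  have "sw_ne_convex V"
    by (rule sw_ne_convex_nonzero_positions[OF assms(1)]) (simp add: assms(2-4))
  then have "initial_complex V I = chain_complex r V {}"
    unfolding assms(5,7) by (rule initial_complex_eq_chain_complex[OF assms(4,6)])
  moreover have "vertex_decomposable (chain_complex r V {})"
  proof (rule vertex_decomposable_chain_complex[OF VG order_refl _ _ _ diag])
    show "height {} < r" using assms(6) height_le_card_rows[of "{}" "{}"] by simp
  qed auto
  ultimately show ?thesis by simp
qed

end
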